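(* There exists a sequence $(f_k)_{k\ge0}\in\mathcal{F}_{\mathrm{NSD}}$ having decreasing critical relations with $f_k\to f_0$ as $k\to\infty$, such that each $f_k$, $k\ge0$, has an acip $\mu_k$, the entropies $h(\mu_k)$ are uniformly bounded away from $0$, and the measures $\mu_k$ converge weak$^*$ to a strictly convex combination of the equilibrium state $\mu_0$ of $f_0$ (for the potential $-\log|Df_0|$) and a Dirac mass on a repelling fixed point of $f_0$.
   Context: A $d$-branched piecewise-monotone map $f$ on a bounded interval $I$ is defined on pairwise-disjoint non-degenerate subintervals $I_1(f),\dots,I_d(f)$, maps each into $I$, continuous and strictly monotone on each; $\mathcal{E}(f)=\bigcup_j\partial I_j(f)$. $f_k\to f_0$: homeomorphisms $h_k:I\to I$ with $h_k(I_j(f_k))=I_j(f_0)$, $h_k\circ f_k\circ h_k^{-1}\to f_0$ uniformly on the domain of $f_0$, $h_k\to\mathrm{id}$ uniformly. Critical relation $(c,c',\sigma,n)$ of $f$: $c\in\mathcal{E}(f)$, $\sigma\in\{\pm1\}$, $n\ge1$ minimal with $\lim_{\epsilon\to0^+}f^n(c+\sigma\epsilon)=c'\in\mathcal{E}(f)$; decreasing critical relations: each critical relation $(c_0,c_0',\sigma,n)$ of $f_0$ yields the critical relation $(h_k^{-1}(c_0),h_k^{-1}(c_0'),\sigma,n)$ of $f_k$. $(f_k)\in\mathcal{F}_{\mathrm{NSD}}$: common $d$, each $f_k$ a $C^2$ diffeomorphism on the interior of each branch with $1/\sqrt{|Df_k|}$ convex, and $\sup_k\sup|Df_k|<\infty$.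 An acip is an invariant probability measure absolutely continuous w.r.t. Lebesgue measure. *)

theory Defs
  imports "HOL-Probability.Probability"
begin

text \<open>A d-branched piecewise-monotone map on the interval I is given by a total
function f together with its branches J 0, ..., J (d-1) (the paper's I_1..I_d).\<close>

definition pm_dom :: "nat \<Rightarrow> (nat \<Rightarrow> real set) \<Rightarrow> real set" where
  "pm_dom d J = (\<Union>j<d. J j)"

definition pm_map :: "real set \<Rightarrow> nat \<Rightarrow> (real \<Rightarrow> real) \<Rightarrow> (nat \<Rightarrow> real set) \<Rightarrow> bool" where
  "pm_map I d f J \<longleftrightarrow>
     bounded I \<and> is_interval I \<and>
     (\<forall>j<d. is_interval (J j) \<and> J j \<subseteq> I \<and> (\<exists>x y. x < y \<and> x \<in> J j \<and> y \<in> J j)) \<and>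
     (\<forall>i<d. \<forall>j<d. i \<noteq> j \<longrightarrow> J i \<inter> J j = {}) \<and>
     (\<forall>j<d. f ` J j \<subseteq> I \<and> continuous_on (J j) f \<and>
            (strict_mono_on (J j) f \<or> strict_mono_on (J j) (\<lambda>x. - f x)))"

definition pm_ends :: "nat \<Rightarrow> (nat \<Rightarrow> real set) \<Rightarrow> real set" where
  "pm_ends d J = (\<Union>j<d. frontier (J j))"

definition pm_deriv :: "nat \<Rightarrow> (real \<Rightarrow> real) \<Rightarrow> (nat \<Rightarrow> real set) \<Rightarrow> real \<Rightarrow> real" where
  "pm_deriv d f J x = (THE D. \<exists>j<d. x \<in> J j \<and> (f has_real_derivative D) (at x within J j))"

definition pm_conv_via ::
  "real set \<Rightarrow> nat \<Rightarrow> (nat \<Rightarrow> real \<Rightarrow> real) \<Rightarrow> (nat \<Rightarrow> nat \<Rightarrow> real set)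
   \<Rightarrow> (nat \<Rightarrow> real \<Rightarrow> real) \<Rightarrow> (nat \<Rightarrow> real \<Rightarrow> real) \<Rightarrow> bool" where
  "pm_conv_via I d F J h g \<longleftrightarrow>
     (\<forall>k\<ge>1. homeomorphism I I (h k) (g k) \<and> (\<forall>j<d. h k ` J k j = J 0 j)) \<and>
     uniform_limit (pm_dom d (J 0)) (\<lambda>k x. h k (F k (g k x))) (F 0) sequentially \<and>
     uniform_limit I h id sequentially"

definition pm_hits :: "nat \<Rightarrow> (real \<Rightarrow> real) \<Rightarrow> (nat \<Rightarrow> real set) \<Rightarrow> real \<Rightarrow> real \<Rightarrow> nat \<Rightarrow> real \<Rightarrow> bool" where
  "pm_hits d f J c \<sigma> m c' \<longleftrightarrow>
     c' \<in> pm_ends d J \<and>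
     (\<forall>\<^sub>F \<epsilon> in at_right 0. \<forall>i<m. (f ^^ i) (c + \<sigma> * \<epsilon>) \<in> pm_dom d J) \<and>
     ((\<lambda>\<epsilon>. (f ^^ m) (c + \<sigma> * \<epsilon>)) \<longlongrightarrow> c') (at_right 0)"

definition crit_rel :: "nat \<Rightarrow> (real \<Rightarrow> real) \<Rightarrow> (nat \<Rightarrow> real set) \<Rightarrow> real \<Rightarrow> real \<Rightarrow> real \<Rightarrow> nat \<Rightarrow> bool" where
  "crit_rel d f J c c' \<sigma> n \<longleftrightarrow>
     c \<in> pm_ends d J \<and> \<sigma> \<in> {1, -1} \<and> n \<ge> 1 \<and> pm_hits d f J c \<sigma> n c' \<and>
     (\<forall>m. 1 \<le> m \<and> m < n \<longrightarrow> \<not> (\<exists>c''. pm_hits d f J c \<sigma> m c''))"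

definition decreasing_crit_rels ::
  "nat \<Rightarrow> (nat \<Rightarrow> real \<Rightarrow> real) \<Rightarrow> (nat \<Rightarrow> nat \<Rightarrow> real set) \<Rightarrow> (nat \<Rightarrow> real \<Rightarrow> real) \<Rightarrow> bool" where
  "decreasing_crit_rels d F J g \<longleftrightarrow>
     (\<forall>k\<ge>1. \<forall>c0 c0' \<sigma> n. crit_rel d (F 0) (J 0) c0 c0' \<sigma> n \<longrightarrow>
        crit_rel d (F k) (J k) (g k c0) (g k c0') \<sigma> n)"

definition C2_diffeo_on :: "real set \<Rightarrow> (real \<Rightarrow> real) \<Rightarrow> bool" where
  "C2_diffeo_on U f \<longleftrightarrow> inj_on f U \<and>
     (\<exists>f' f''. \<forall>x\<in>U. (f has_real_derivative f' x) (at x) \<and>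
                      (f' has_real_derivative f'' x) (at x) \<and> isCont f'' x \<and> f' x \<noteq> 0)"

definition NSD_family :: "real set \<Rightarrow> nat \<Rightarrow> (nat \<Rightarrow> real \<Rightarrow> real) \<Rightarrow> (nat \<Rightarrow> nat \<Rightarrow> real set) \<Rightarrow> bool" where
  "NSD_family I d F J \<longleftrightarrow>
     (\<forall>k. pm_map I d (F k) (J k)) \<and>
     (\<forall>k. \<forall>j<d. C2_diffeo_on (interior (J k j)) (F k) \<and>
               convex_on (interior (J k j)) (\<lambda>x. 1 / sqrt \<bar>deriv (F k) x\<bar>)) \<and>
     (\<exists>M. \<forall>k. \<forall>j<d. \<forall>x\<in>interior (J k j). \<bar>deriv (F k) x\<bar> \<le> M)"

definition invariant_prob :: "nat \<Rightarrow> (real \<Rightarrow> real) \<Rightarrow> (nat \<Rightarrow> real set) \<Rightarrow> real measure \<Rightarrow> bool" where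
  "invariant_prob d f J \<mu> \<longleftrightarrow>
     prob_space \<mu> \<and> sets \<mu> = sets borel \<and> measure \<mu> (pm_dom d J) = 1 \<and>
     (\<forall>A\<in>sets borel. measure \<mu> {x \<in> pm_dom d J. f x \<in> A} = measure \<mu> A)"

definition acip :: "nat \<Rightarrow> (real \<Rightarrow> real) \<Rightarrow> (nat \<Rightarrow> real set) \<Rightarrow> real measure \<Rightarrow> bool" where
  "acip d f J \<mu> \<longleftrightarrow> invariant_prob d f J \<mu> \<and> absolutely_continuous lborel \<mu>"

definition meas_partition :: "real set \<Rightarrow> real set set \<Rightarrow> bool" where
  "meas_partition D P \<longleftrightarrow> finite P \<and> P \<subseteq> sets borel \<and> \<Union>P = D \<and> pairwise disjnt P"

definition cylinders :: "(real \<Rightarrow> real) \<Rightarrow> real set set \<Rightarrow> nat \<Rightarrow> real set set" where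
  "cylinders f P n = {C. \<exists>w. (\<forall>i<n. w i \<in> P) \<and> C = {x. \<forall>i<n. (f ^^ i) x \<in> w i}}"

definition part_entropy :: "real measure \<Rightarrow> real set set \<Rightarrow> real" where
  "part_entropy \<mu> Q = (\<Sum>C\<in>Q. - measure \<mu> C * ln (measure \<mu> C))"

definition entropy_wrt :: "real measure \<Rightarrow> (real \<Rightarrow> real) \<Rightarrow> real set set \<Rightarrow> real" where
  "entropy_wrt \<mu> f P = lim (\<lambda>n. part_entropy \<mu> (cylinders f P n) / real n)"

definition ks_entropy :: "nat \<Rightarrow> (real \<Rightarrow> real) \<Rightarrow> (nat \<Rightarrow> real set) \<Rightarrow> real measure \<Rightarrow> ereal" where
  "ks_entropy d f J \<mu> = (SUP P \<in> {P. meas_partition (pm_dom d J) P}. ereal (entropy_wrt \<mu> f P))"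

text \<open>Lyapunov exponent: the integral of log|Df|, with values in [-inf, inf).\<close>
definition lyapunov :: "nat \<Rightarrow> (real \<Rightarrow> real) \<Rightarrow> (nat \<Rightarrow> real set) \<Rightarrow> real measure \<Rightarrow> ereal" where
  "lyapunov d f J \<mu> =
     enn2ereal (\<integral>\<^sup>+ x. ennreal (max 0 (ln \<bar>pm_deriv d f J x\<bar>)) \<partial>\<mu>)
     - enn2ereal (\<integral>\<^sup>+ x. ennreal (max 0 (- ln \<bar>pm_deriv d f J x\<bar>)) \<partial>\<mu>)"

definition equilibrium_state :: "nat \<Rightarrow> (real \<Rightarrow> real) \<Rightarrow> (nat \<Rightarrow> real set) \<Rightarrow> real measure \<Rightarrow> bool" where
  "equilibrium_state d f J \<mu> \<longleftrightarrow> invariant_prob d f J \<mu> \<and>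
     (\<forall>\<nu>. invariant_prob d f J \<nu> \<longrightarrow>
        ks_entropy d f J \<nu> - lyapunov d f J \<nu> \<le> ks_entropy d f J \<mu> - lyapunov d f J \<mu>)"

definition repelling_fixed_point :: "nat \<Rightarrow> (real \<Rightarrow> real) \<Rightarrow> (nat \<Rightarrow> real set) \<Rightarrow> real \<Rightarrow> bool" where
  "repelling_fixed_point d f J p \<longleftrightarrow>
     (\<exists>j<d. p \<in> J j \<and> f p = p \<and> (\<exists>D. (f has_real_derivative D) (at p within J j) \<and> \<bar>D\<bar> > 1))"

definition weak_star_conv :: "(nat \<Rightarrow> real measure) \<Rightarrow> real measure \<Rightarrow> bool" where
  "weak_star_conv \<mu>s \<nu> \<longleftrightarrow>
     (\<forall>g :: real \<Rightarrow> real. continuous_on UNIV g \<and> bounded (range g) \<longrightarrow>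
        (\<lambda>k. \<integral>x. g x \<partial>\<mu>s k) \<longlonglongrightarrow> (\<integral>x. g x \<partial>\<nu>))"

end

theory Submission
  imports Defs
begin

text \<open>
  All maps have five affine or quadratic branches and live on two regions that do not communicate.
  On \<open>(6, 7)\<close> every map is the doubling map; this carries \<open>\<mu>\<^sub>0\<close>, which is Lebesgue measure there.
  Near \<open>4\<close> the maps are \<open>x \<mapsto> 2 x - 4\<close>, and the two branches ending at \<open>0\<close> are given by
  \<open>x \<mapsto> 4 - \<delta>\<^sub>k + x\<^sup>2\<close> with \<open>\<delta>\<^sub>0 = 0\<close>.

  For \<open>k \<ge> 1\<close> the number \<open>\<delta>\<^sub>k > 0\<close> is tuned so that the interval of radius \<open>2\<^bsup>-k\<^esup>\<close> around \<open>0\<close> is mapped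
  just below \<open>4\<close>, is pushed away from this repelling fixed point for \<open>k + 1\<close> steps, and then returns
  onto itself by a rescaled Chebyshev map \<open>x \<mapsto> 2 x\<^sup>2 - 1\<close>. The averaged arcsine law along this cycle
  is an acip that spends all but boundedly many steps near \<open>4\<close>, so it tends to the Dirac mass at \<open>4\<close>;
  its mean with \<open>\<mu>\<^sub>0\<close> is \<open>\<mu>\<^sub>k\<close>, and \<open>\<mu>\<^sub>0\<close> alone keeps the entropy at least \<open>ln 2 / 2\<close>.

  The orbit of \<open>0\<close> under the limit map stays at \<open>4\<close>, which is no endpoint, and the other endpoints outside
  \<open>[6, 7]\<close> fall into a gap of the domain; hence all critical relations of the limit map belong to the doubling map.
  As \<open>4 + x\<^sup>2 > 4\<close>, orbits of the limit map passing near \<open>0\<close> are expelled from the domain on the right of \<open>4\<close>.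
  So its invariant measures live on \<open>{4} \<union> (6, 7)\<close>, where the slope is \<open>2\<close>. All Lyapunov exponents are
  therefore \<open>ln 2\<close>, and being an equilibrium state means having the maximal entropy \<open>ln 2\<close>.
\<close>

section \<open>Entropy of finite partitions\<close>

text \<open>Fekete's lemma: the limit is the infimum of the ratios over \<open>n \<ge> 1\<close>.
  For an \<open>m\<close> whose ratio is nearly minimal, dividing \<open>n\<close> by
  \<open>m\<close> leaves a remainder term that is bounded and disappears after division by
  \<open>n\<close>.\<close>

lemma subadditive_ratio_convergent:
  fixes a :: "nat \<Rightarrow> real"
  assumes nonneg: "\<And>n. 0 \<le> a n" and sub: "\<And>m n. a (m + n) \<le> a m + a n"
  shows "convergent (\<lambda>n. a n / real n)"
proof -
  define S where "S = (\<lambda>n. a n / real n) ` {1..}"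
  define L where "L = Inf S"
  have bdd: "bdd_below S"
    unfolding S_def by (rule bdd_belowI[of _ 0]) (auto simp: nonneg)
  have mult: "a (q * m + r) \<le> real q * a m + a r" for q m r
  proof (induction q)
    case (Suc q)
    have "a (Suc q * m + r) = a (m + (q * m + r))" by (simp add: algebra_simps)
    also have "\<dots> \<le> a m + a (q * m + r)" by (rule sub)
    finally show ?case using Suc by (simp add: algebra_simps)
  qed simp
  have "(\<lambda>n. a n / real n) \<longlonglongrightarrow> L"
  proof (rule LIMSEQ_I)
    fix e :: real assume e: "e > 0"
    have "Inf S < L + e / 2" using e by (simp add: L_def)
    then obtain s where "s \<in> S" "s < L + e / 2"
      using cInf_lessD[of S "L + e/2"] by (auto simp: S_def)
    then obtain m where m: "m \<ge> 1" "a m / real m < L + e / 2" by (auto simp: S_def)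
    define C where "C = (\<Sum>i<m. a i)"
    have upper: "a n / real n \<le> a m / real m + C / real n" if n: "n \<ge> 1" for n
    proof -
      have "a (n mod m) \<le> C" unfolding C_def
        using m(1) by (intro member_le_sum) (auto simp: nonneg)
      moreover have "a n \<le> real (n div m) * a m + a (n mod m)"
        using mult[of "n div m" m "n mod m"] by simp
      moreover have "real (n div m) * a m \<le> real n / real m * a m"
        by (intro mult_right_mono nonneg of_nat_div_le_of_nat)
      ultimately have "a n \<le> real n / real m * a m + C" by linarith
      then have "a n / real n \<le> (real n / real m * a m + C) / real n"
        by (intro divide_right_mono) auto
      also have "\<dots> = a m / real m + C / real n" using n by (simp add: field_simps)
      finally show ?thesis .
    qed
    obtain N where N: "real N > 2 * C / e" using reals_Archimedean2 by blast
    show "\<exists>no. \<forall>n\<ge>no. norm (a n / real n - L) < e"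
    proof (intro exI[of _ "max 1 N"] allI impI)
      fix n assume n: "n \<ge> max 1 N"
      have "C / real n < e / 2"
      proof -
        have "real n > 2 * C / e" using N n by (smt (verit) max.boundedE of_nat_mono)
        then show ?thesis using n e by (simp add: field_simps)
      qed
      moreover have "L \<le> a n / real n" unfolding L_def
        by (rule cInf_lower[OF _ bdd]) (use n in \<open>auto simp: S_def\<close>)
      moreover have "a n / real n \<le> a m / real m + C / real n" using upper n by simp
      ultimately show "norm (a n / real n - L) < e"
        unfolding real_norm_def using m(2) e by linarith
    qed
  qed
  then show ?thesis by (rule convergentI)
qed

text \<open>Apply \<open>ln t \<le> t - 1\<close> to \<open>t = q w / p w\<close> and sum. Where
  \<open>p w = 0\<close> both logarithmic terms vanish because of the factor. Asking only for
  \<open>sum q W \<le> sum p W\<close> leaves room for comparison laws of total mass below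
  one.\<close>

lemma gibbs_inequality:
  fixes p q :: "'a \<Rightarrow> real"
  assumes fin: "finite W" and p: "\<And>w. w \<in> W \<Longrightarrow> 0 \<le> p w" and q: "\<And>w. w \<in> W \<Longrightarrow> 0 \<le> q w"
    and pos: "\<And>w. w \<in> W \<Longrightarrow> 0 < p w \<Longrightarrow> 0 < q w"
    and sums: "sum q W \<le> sum p W"
  shows "(\<Sum>w\<in>W. - p w * ln (p w)) \<le> (\<Sum>w\<in>W. - p w * ln (q w))"
proof -
  have "- p w * ln (p w) \<le> - p w * ln (q w) + (q w - p w)" if w: "w \<in> W" for w
  proof (cases "p w = 0")
    case True then show ?thesis using q[OF w] by simp
  next
    case False
    then have pp: "p w > 0" and qq: "q w > 0" using p[OF w] pos[OF w] by auto
    have "ln (q w / p w) \<le> q w / p w - 1" using pp qq by (intro ln_le_minus_one) auto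
    then have "p w * (ln (q w) - ln (p w)) \<le> p w * (q w / p w - 1)"
      using pp qq by (intro mult_left_mono) (auto simp: ln_div)
    then show ?thesis using pp by (simp add: algebra_simps)
  qed
  then have "(\<Sum>w\<in>W. - p w * ln (p w)) \<le> (\<Sum>w\<in>W. - p w * ln (q w) + (q w - p w))"
    by (intro sum_mono)
  also have "\<dots> = (\<Sum>w\<in>W. - p w * ln (q w)) + (sum q W - sum p W)"
    by (simp add: sum.distrib sum_subtractf sum_negf)
  finally show ?thesis using sums by linarith
qed

text \<open>In \<open>cylinders\<close> a word is a function on all naturals, with arbitrary values
  from \<open>n\<close> on. Lists of length \<open>n\<close> give a finite index set, so that sums
  over words can be split and exchanged.\<close>

definition words :: "'a set \<Rightarrow> nat \<Rightarrow> 'a list set" where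
  "words P n = {w. set w \<subseteq> P \<and> length w = n}"

definition word_cyl :: "('a \<Rightarrow> 'a) \<Rightarrow> 'a set list \<Rightarrow> 'a set" where
  "word_cyl f w = {x. \<forall>i<length w. (f ^^ i) x \<in> w ! i}"

lemma finite_words: "finite P \<Longrightarrow> finite (words P n)"
  unfolding words_def by (rule finite_lists_length_eq)

lemma cylinders_eq_words: "cylinders f P n = word_cyl f ` words P n"
proof (intro equalityI subsetI)
  fix C assume "C \<in> cylinders f P n"
  then obtain w where w: "\<forall>i<n. w i \<in> P" "C = {x. \<forall>i<n. (f ^^ i) x \<in> w i}"
    unfolding cylinders_def by auto
  have "C = word_cyl f (map w [0..<n])" using w(2) by (auto simp: word_cyl_def)
  moreover have "map w [0..<n] \<in> words P n" using w(1) by (auto simp: words_def)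
  ultimately show "C \<in> word_cyl f ` words P n" by blast
next
  fix C assume "C \<in> word_cyl f ` words P n"
  then obtain w where w: "w \<in> words P n" "C = word_cyl f w" by auto
  then show "C \<in> cylinders f P n"
    unfolding cylinders_def by (intro CollectI exI[of _ "(!) w"]) (auto simp: words_def word_cyl_def)
qed

lemma word_cyl_append:
  "word_cyl f (u @ v) = word_cyl f u \<inter> (f ^^ length u) -` word_cyl f v"
proof -
  have "(\<forall>i<length u + length v. (f ^^ i) x \<in> (u @ v) ! i) \<longleftrightarrow>
        (\<forall>i<length u. (f ^^ i) x \<in> u ! i) \<and> (\<forall>i<length v. (f ^^ i) ((f ^^ length u) x) \<in> v ! i)"
    (is "?l \<longleftrightarrow> ?r") for x
  proof
    assume l: ?l
    show ?r
    proof (intro conjI allI impI)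
      fix i assume "i < length u"
      then show "(f ^^ i) x \<in> u ! i" using l[rule_format, of i] by (simp add: nth_append)
    next
      fix i assume "i < length v"
      then show "(f ^^ i) ((f ^^ length u) x) \<in> v ! i"
        using l[rule_format, of "length u + i"]
        by (simp add: nth_append add.commute[of "length u"] funpow_add)
    qed
  next
    assume r: ?r
    show ?l
    proof (intro allI impI)
      fix i assume i: "i < length u + length v"
      show "(f ^^ i) x \<in> (u @ v) ! i"
      proof (cases "i < length u")
        case True then show ?thesis using r by (simp add: nth_append)
      next
        case False
        then obtain j where j: "i = j + length u" by (metis add.commute le_Suc_ex linorder_not_less)
        then show ?thesis using r i by (simp add: nth_append funpow_add)
      qed
    qed
  qed
  then show ?thesis by (auto simp: word_cyl_def)
qed

lemma sum_words_add:
  assumes "finite P"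
  shows "(\<Sum>w\<in>words P (m + n). g w) = (\<Sum>u\<in>words P m. \<Sum>v\<in>words P n. g (u @ v))"
proof -
  have "(\<Sum>u\<in>words P m. \<Sum>v\<in>words P n. g (u @ v)) = (\<Sum>(u, v)\<in>words P m \<times> words P n. g (u @ v))"
    by (rule sum.cartesian_product)
  also have "\<dots> = (\<Sum>w\<in>words P (m + n). g w)"
    by (rule sum.reindex_bij_witness[where i = "\<lambda>w. (take m w, drop m w)" and j = "\<lambda>(u, v). u @ v"])
       (auto simp: words_def dest: in_set_takeD in_set_dropD)
  finally show ?thesis ..
qed

text \<open>Preimages are taken under the total function \<open>f\<close>, without intersecting with
  the domain. As \<open>D\<close> has full measure this changes no probability, and preimages under
  iterates become plain compositions.\<close>

locale borel_system = prob_space M for M :: "real measure" +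
  fixes f :: "real \<Rightarrow> real" and D :: "real set"
  assumes sets_M [measurable_cong]: "sets M = sets borel"
    and f_measurable [measurable]: "f \<in> borel_measurable borel"
    and D_sets [measurable]: "D \<in> sets borel" and prob_D: "prob D = 1"
    and inv: "A \<in> sets borel \<Longrightarrow> prob (f -` A) = prob A"
begin

lemma space_M [simp]: "space M = UNIV"
  using sets_eq_imp_space_eq[OF sets_M] by simp

lemma funpow_measurable [measurable]: "(f ^^ n) \<in> borel_measurable borel"
proof (induction n)
  case (Suc n)
  note Suc[measurable]
  show ?case by (simp add: comp_def)
qed (simp add: id_def)

lemma funpow_vimage_sets: "A \<in> sets borel \<Longrightarrow> (f ^^ n) -` A \<in> sets borel"
  using measurable_sets[OF funpow_measurable] by simp

lemma inv_funpow: "A \<in> sets borel \<Longrightarrow> prob ((f ^^ n) -` A) = prob A"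
proof (induction n)
  case (Suc n)
  have "(f ^^ Suc n) -` A = f -` ((f ^^ n) -` A)" by (auto simp: funpow_swap1)
  then show ?case using inv[OF funpow_vimage_sets[OF Suc.prems]] Suc by (simp del: funpow.simps)
qed simp

text \<open>By invariance each preimage of \<open>D\<close> has full measure, and there are
  countably many. Hence cylinders cover almost every point, and only points that never leave the
  domain carry mass.\<close>

lemma AE_funpow_D: "AE x in M. \<forall>n. (f ^^ n) x \<in> D"
proof -
  have "AE x in M. x \<in> (f ^^ n) -` D" for n
    using inv_funpow[OF D_sets, of n] funpow_vimage_sets[OF D_sets, of n] prob_D
    by (intro prob_eq_1[THEN iffD1]) (auto simp: sets_M)
  then show ?thesis by (simp add: AE_all_countable)
qed

end

locale borel_partition = borel_system +
  fixes P :: "real set set"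
  assumes partition: "meas_partition D P"
begin

lemma finite_P: "finite P" and P_sets: "a \<in> P \<Longrightarrow> a \<in> sets borel" and Union_P: "\<Union>P = D"
  and P_disjoint: "a \<in> P \<Longrightarrow> b \<in> P \<Longrightarrow> x \<in> a \<Longrightarrow> x \<in> b \<Longrightarrow> a = b"
  using partition unfolding meas_partition_def pairwise_def disjnt_def by blast+

lemma word_cyl_sets [measurable]: "w \<in> words P n \<Longrightarrow> word_cyl f w \<in> sets borel"
proof -
  assume w: "w \<in> words P n"
  have "word_cyl f w = (\<Inter>i\<in>{..<length w}. (f ^^ i) -` (w ! i))"
    by (auto simp: word_cyl_def)
  also have "\<dots> \<in> sets borel"
  proof (cases "w = []")
    case False
    then show ?thesis using w
      by (intro sets.finite_INT funpow_vimage_sets P_sets) (auto simp: words_def)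
  qed simp
  finally show ?thesis .
qed

lemma word_cyl_disjoint:
  assumes "u \<in> words P n" "v \<in> words P n" "x \<in> word_cyl f u" "x \<in> word_cyl f v"
  shows "u = v"
proof (rule nth_equalityI)
  show "length u = length v" using assms by (simp add: words_def)
  fix i assume "i < length u"
  then show "u ! i = v ! i"
    using assms by (intro P_disjoint[of _ _ "(f ^^ i) x"]) (auto simp: words_def word_cyl_def subset_iff)
qed

lemma word_cyl_exists:
  assumes "\<forall>n. (f ^^ n) x \<in> D"
  shows "\<exists>w\<in>words P n. x \<in> word_cyl f w"
proof -
  have "\<forall>i. \<exists>a\<in>P. (f ^^ i) x \<in> a" using assms Union_P by blast
  then obtain c where c: "\<And>i. c i \<in> P" "\<And>i. (f ^^ i) x \<in> c i" by metis
  then show ?thesis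
    by (intro bexI[of _ "map c [0..<n]"]) (auto simp: words_def word_cyl_def)
qed

lemma sum_prob_word_cyl_Int:
  assumes A: "A \<in> sets borel"
  shows "(\<Sum>w\<in>words P n. prob (A \<inter> word_cyl f w)) = prob A"
proof -
  have "(\<Sum>w\<in>words P n. prob (A \<inter> word_cyl f w)) = prob (\<Union>w\<in>words P n. A \<inter> word_cyl f w)"
    using word_cyl_disjoint A finite_words[OF finite_P]
    by (intro finite_measure_finite_Union[symmetric]) (auto simp: disjoint_family_on_def sets_M)
  also have "\<dots> = prob A"
  proof (rule finite_measure_eq_AE)
    show "AE x in M. (x \<in> (\<Union>w\<in>words P n. A \<inter> word_cyl f w)) = (x \<in> A)"
      using AE_funpow_D by eventually_elim (use word_cyl_exists in blast)
    show "(\<Union>w\<in>words P n. A \<inter> word_cyl f w) \<in> events"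
      using A finite_words[OF finite_P] by (auto simp: sets_M)
  qed (use A in \<open>simp add: sets_M\<close>)
  finally show ?thesis .
qed

lemma sum_prob_word_cyl: "(\<Sum>w\<in>words P n. prob (word_cyl f w)) = 1"
  using sum_prob_word_cyl_Int[of UNIV n] prob_space by simp

text \<open>\<open>part_entropy\<close> sums over a set of cylinders, the right side over words. Two
  different words share a cylinder only if it is empty, and then the summand is zero.\<close>

lemma part_entropy_eq_words:
  "part_entropy M (cylinders f P n) =
    (\<Sum>w\<in>words P n. - prob (word_cyl f w) * ln (prob (word_cyl f w)))"
  unfolding part_entropy_def cylinders_eq_words
proof (rule trans[OF sum.reindex_nontrivial])
  fix u v assume uv: "u \<in> words P n" "v \<in> words P n" "u \<noteq> v" "word_cyl f u = word_cyl f v"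
  then have "word_cyl f u = {}" using word_cyl_disjoint by blast
  then show "- prob (word_cyl f u) * ln (prob (word_cyl f u)) = 0" by simp
qed (simp_all add: finite_words finite_P)

lemma part_entropy_nonneg: "0 \<le> part_entropy M (cylinders f P n)"
  unfolding part_entropy_eq_words
proof (rule sum_nonneg)
  fix w
  have "prob (word_cyl f w) * ln (prob (word_cyl f w)) \<le> 0"
    by (cases "prob (word_cyl f w) = 0")
       (auto intro!: mult_nonneg_nonpos simp: zero_less_measure_iff)
  then show "0 \<le> - prob (word_cyl f w) * ln (prob (word_cyl f w))" by simp
qed

text \<open>Gibbs' inequality against the product of the two marginals: the law of words of length
  \<open>m + n\<close> is compared with independent choices of the first \<open>m\<close> and the
  last \<open>n\<close> letters. The logarithm of the product splits, and summing out one block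
  leaves the entropy of the other.\<close>

lemma part_entropy_subadditive:
  "part_entropy M (cylinders f P (m + n)) \<le>
    part_entropy M (cylinders f P m) + part_entropy M (cylinders f P n)"
proof -
  let ?p = "\<lambda>w. prob (word_cyl f w)"
  let ?q = "\<lambda>w. ?p (take m w) * ?p (drop m w)"
  have td: "take m w \<in> words P m" "drop m w \<in> words P n" if "w \<in> words P (m + n)" for w
    using that by (auto simp: words_def dest: in_set_takeD in_set_dropD)
  have app: "u @ v \<in> words P (m + n)" if "u \<in> words P m" "v \<in> words P n" for u v
    using that by (auto simp: words_def)
  have tda: "take m (u @ v) = u" "drop m (u @ v) = v" if "u \<in> words P m" for u v :: "real set list"
    using that by (auto simp: words_def)
  have cyl: "word_cyl f (u @ v) = word_cyl f u \<inter> (f ^^ m) -` word_cyl f v" if "u \<in> words P m" for u v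
    using that word_cyl_append[of f u v] by (simp add: words_def)
  have marg1: "(\<Sum>v\<in>words P n. ?p (u @ v)) = ?p u" if u: "u \<in> words P m" for u
  proof -
    have "(\<Sum>v\<in>words P n. ?p (u @ v)) = prob (\<Union>v\<in>words P n. word_cyl f (u @ v))"
      using word_cyl_sets[OF app[OF u]] finite_words[OF finite_P]
        word_cyl_disjoint[OF app[OF u] app[OF u]]
      by (intro finite_measure_finite_Union[symmetric]) (auto simp: disjoint_family_on_def sets_M)
    also have "\<dots> = ?p u"
    proof (rule finite_measure_eq_AE)
      show "AE x in M. (x \<in> (\<Union>v\<in>words P n. word_cyl f (u @ v))) = (x \<in> word_cyl f u)"
        using AE_funpow_D
      proof eventually_elim
        case (elim x)
        then have "\<forall>i. (f ^^ i) ((f ^^ m) x) \<in> D"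
          by (metis comp_apply funpow_add)
        from word_cyl_exists[OF this, of n] show ?case unfolding cyl[OF u] by blast
      qed
      show "(\<Union>v\<in>words P n. word_cyl f (u @ v)) \<in> events"
        using word_cyl_sets[OF app[OF u]] finite_words[OF finite_P] by (auto simp: sets_M)
    qed (use word_cyl_sets[OF u] in \<open>simp add: sets_M\<close>)
    finally show ?thesis .
  qed
  \<comment> \<open>This marginal needs invariance: the last \<open>n\<close> letters describe the
    point \<open>(f ^^ m) x\<close>.\<close>
  have marg2: "(\<Sum>u\<in>words P m. ?p (u @ v)) = ?p v" if v: "v \<in> words P n" for v
  proof -
    have "(\<Sum>u\<in>words P m. ?p (u @ v)) = (\<Sum>u\<in>words P m. prob ((f ^^ m) -` word_cyl f v \<inter> word_cyl f u))"
      by (intro sum.cong refl) (simp add: cyl Int_commute)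
    also have "\<dots> = ?p v"
      using word_cyl_sets[OF v]
      by (simp add: sum_prob_word_cyl_Int[OF funpow_vimage_sets] inv_funpow)
    finally show ?thesis .
  qed
  \<comment> \<open>Both factors of \<open>?q\<close> are positive wherever \<open>?p\<close> is, as
    Gibbs' inequality and the splitting of the logarithm require.\<close>
  have mono: "?p w \<le> ?p (take m w)" "?p w \<le> ?p (drop m w)" if w: "w \<in> words P (m + n)" for w
  proof -
    let ?u = "take m w" and ?v = "drop m w"
    have "?p (?u @ ?v) \<le> ?p ?u"
      unfolding cyl[OF td(1)[OF w]]
      by (intro finite_measure_mono) (use word_cyl_sets td[OF w] in \<open>auto simp: sets_M\<close>)
    then show "?p w \<le> ?p ?u" by simp
    have "?p (?u @ ?v) \<le> prob ((f ^^ m) -` word_cyl f ?v)"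
      unfolding cyl[OF td(1)[OF w]]
      by (intro finite_measure_mono)
         (use funpow_vimage_sets[OF word_cyl_sets] td[OF w] in \<open>auto simp: sets_M\<close>)
    then show "?p w \<le> ?p ?v" using inv_funpow[OF word_cyl_sets[OF td(2)[OF w]]] by simp
  qed
  have "part_entropy M (cylinders f P (m + n)) \<le> (\<Sum>w\<in>words P (m + n). - ?p w * ln (?q w))"
    unfolding part_entropy_eq_words
  proof (rule gibbs_inequality)
    have "sum ?q (words P (m + n)) = (\<Sum>u\<in>words P m. \<Sum>v\<in>words P n. ?p u * ?p v)"
      unfolding sum_words_add[OF finite_P] by (intro sum.cong refl) (simp only: tda)
    also have "\<dots> = 1" by (simp add: sum_product[symmetric] sum_prob_word_cyl)
    finally show "sum ?q (words P (m + n)) \<le> sum ?p (words P (m + n))"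
      by (simp add: sum_prob_word_cyl)
    show "0 < ?q w" if "w \<in> words P (m + n)" "0 < ?p w" for w
      using mono[OF that(1)] that(2) by (intro mult_pos_pos) linarith+
  qed (auto simp: finite_words finite_P)
  also have "\<dots> = (\<Sum>w\<in>words P (m + n). - ?p w * ln (?p (take m w)) + - ?p w * ln (?p (drop m w)))"
  proof (intro sum.cong refl)
    fix w assume w: "w \<in> words P (m + n)"
    show "- ?p w * ln (?q w) = - ?p w * ln (?p (take m w)) + - ?p w * ln (?p (drop m w))"
    proof (cases "?p w = 0")
      case False
      then have "?p (take m w) > 0" "?p (drop m w) > 0"
        using mono[OF w] zero_less_measure_iff[of M "word_cyl f w"] by linarith+
      then show ?thesis by (simp add: ln_mult algebra_simps)
    qed simp
  qed
  also have "\<dots> = (\<Sum>u\<in>words P m. \<Sum>v\<in>words P n. - ?p (u @ v) * ln (?p u)) +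
      (\<Sum>u\<in>words P m. \<Sum>v\<in>words P n. - ?p (u @ v) * ln (?p v))"
    unfolding sum_words_add[OF finite_P] sum.distrib[symmetric]
    by (intro sum.cong refl) (simp only: tda)
  also have "(\<Sum>u\<in>words P m. \<Sum>v\<in>words P n. - ?p (u @ v) * ln (?p u)) =
      part_entropy M (cylinders f P m)"
    unfolding part_entropy_eq_words
    by (intro sum.cong refl) (simp add: sum_negf sum_distrib_right[symmetric] marg1)
  also have "(\<Sum>u\<in>words P m. \<Sum>v\<in>words P n. - ?p (u @ v) * ln (?p v)) =
      part_entropy M (cylinders f P n)"
    unfolding part_entropy_eq_words
    by (subst sum.swap, intro sum.cong refl) (simp add: sum_negf sum_distrib_right[symmetric] marg2)
  finally show ?thesis .
qed

text \<open>\<open>lim\<close> in \<open>entropy_wrt\<close> is thereby an actual limit, so that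
  bounds for each \<open>n\<close> pass to the entropy.\<close>

lemma entropy_wrt_LIMSEQ:
  "(\<lambda>n. part_entropy M (cylinders f P n) / real n) \<longlonglongrightarrow> entropy_wrt M f P"
  unfolding entropy_wrt_def convergent_LIMSEQ_iff[symmetric]
  by (intro subadditive_ratio_convergent part_entropy_nonneg part_entropy_subadditive)

end

section \<open>An upper bound for the entropy\<close>

text \<open>The total mass of a law with independent letters; the weights may depend on the
  position, because the guessed letter does.\<close>

lemma sum_words_prod:
  fixes h :: "nat \<Rightarrow> 'a \<Rightarrow> real"
  assumes fin: "finite P"
  shows "(\<Sum>w\<in>words P n. \<Prod>i<n. h i (w ! i)) = (\<Prod>i<n. \<Sum>a\<in>P. h i a)"
proof (induction n)
  case 0
  have "words P 0 = {[]}" by (auto simp: words_def)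
  then show ?case by simp
next
  case (Suc n)
  have w1: "words P 1 = (\<lambda>a. [a]) ` P"
    by (auto simp: words_def length_Suc_conv)
  have "(\<Sum>w\<in>words P (n + 1). \<Prod>i<Suc n. h i (w ! i)) =
      (\<Sum>u\<in>words P n. \<Sum>a\<in>P. \<Prod>i<Suc n. h i ((u @ [a]) ! i))"
    unfolding sum_words_add[OF fin] w1
    by (intro sum.cong refl) (subst sum.reindex, auto simp: inj_on_def)
  also have "\<dots> = (\<Sum>u\<in>words P n. (\<Prod>i<n. h i (u ! i)) * (\<Sum>a\<in>P. h n a))"
  proof (intro sum.cong refl)
    fix u assume "u \<in> words P n"
    then have len: "length u = n" by (simp add: words_def)
    have "(\<Prod>i<n. h i ((u @ [a]) ! i)) = (\<Prod>i<n. h i (u ! i))" for a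
      by (intro prod.cong) (auto simp: nth_append len)
    then show "(\<Sum>a\<in>P. \<Prod>i<Suc n. h i ((u @ [a]) ! i)) = (\<Prod>i<n. h i (u ! i)) * (\<Sum>a\<in>P. h n a)"
      by (simp add: sum_distrib_left nth_append len)
  qed
  also have "\<dots> = (\<Prod>i<Suc n. \<Sum>a\<in>P. h i a)"
    by (simp add: sum_distrib_right[symmetric] Suc)
  finally show ?case by simp
qed

definition itinerary :: "('a \<Rightarrow> 'a) \<Rightarrow> ('a \<Rightarrow> 'b) \<Rightarrow> nat \<Rightarrow> 'a \<Rightarrow> 'b list" where
  "itinerary f s n x = map (\<lambda>i. s ((f ^^ i) x)) [0..<n]"

lemma length_itinerary [simp]: "length (itinerary f s n x) = n"
  by (simp add: itinerary_def)

lemma itinerary_funpow: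
  assumes "i + m \<le> n"
  shows "itinerary f s m ((f ^^ i) x) = take m (drop i (itinerary f s n x))"
proof (rule nth_equalityI)
  fix j assume "j < length (itinerary f s m ((f ^^ i) x))"
  then have j: "j < m" by simp
  have "(f ^^ j) ((f ^^ i) x) = (f ^^ (i + j)) x"
    by (simp add: add.commute[of i j] funpow_add)
  then show "itinerary f s m ((f ^^ i) x) ! j = take m (drop i (itinerary f s n x)) ! j"
    using j assms by (simp add: itinerary_def)
qed (use assms in simp)

lemma x_ln_x_tendsto_0: "((\<lambda>x::real. x * ln x) \<longlongrightarrow> 0) (at_right 0)"
proof -
  have "((\<lambda>x::real. - (ln x / x)) \<longlongrightarrow> 0) at_top"
    using tendsto_minus[OF ln_x_over_x_tendsto_0] by simp
  then have "((\<lambda>x::real. inverse x * ln (inverse x)) \<longlongrightarrow> 0) at_top"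
    by (rule Lim_transform_eventually)
       (use eventually_gt_at_top[of 0] in \<open>eventually_elim, auto simp: ln_div field_simps\<close>)
  then show ?thesis by (subst filterlim_at_right_to_top)
qed

context borel_partition
begin

text \<open>Inner regularity lets every atom lose at most \<open>\<eta> / card P\<close> of its
  mass. Compactness is wanted because disjoint compact sets have a positive distance.\<close>

lemma compact_approximation:
  assumes "0 < \<eta>"
  shows "\<exists>K. (\<forall>a\<in>P. compact (K a) \<and> K a \<subseteq> a) \<and> prob (- (\<Union>a\<in>P. K a)) \<le> \<eta>"
proof -
  have fm: "emeasure M (space M) \<noteq> \<infinity>" using emeasure_space_1 by simp
  have "P \<noteq> {}" using Union_P prob_D by auto
  then have N: "card P > 0" using finite_P by (simp add: card_gt_0_iff)
  have "\<exists>K. compact K \<and> K \<subseteq> a \<and> prob a - \<eta> / card P < prob K" if a: "a \<in> P" for a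
  proof (cases "prob a = 0")
    case True
    then show ?thesis using assms N by (intro exI[of _ "{}"]) simp
  next
    case False
    then have pa: "prob a > 0" by (simp add: zero_less_measure_iff)
    have "ennreal (prob a - \<eta> / card P) < emeasure M a"
      unfolding emeasure_eq_measure using assms N pa by (intro ennreal_lessI) auto
    also have "emeasure M a = (SUP K\<in>{K. K \<subseteq> a \<and> compact K}. emeasure M K)"
      by (rule inner_regular[OF sets_M fm P_sets[OF a]])
    finally obtain K where K: "K \<subseteq> a" "compact K" "ennreal (prob a - \<eta> / card P) < emeasure M K"
      by (auto simp: less_SUP_iff)
    then have "prob a - \<eta> / card P < prob K"
      unfolding emeasure_eq_measure by (metis ennreal_leI linorder_not_less)
    then show ?thesis using K by blast
  qed
  then obtain K where K: "\<And>a. a \<in> P \<Longrightarrow> compact (K a)" "\<And>a. a \<in> P \<Longrightarrow> K a \<subseteq> a"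
    "\<And>a. a \<in> P \<Longrightarrow> prob a - \<eta> / card P < prob (K a)" by metis
  have Ks: "a \<in> P \<Longrightarrow> K a \<in> events" for a using K(1) borel_compact sets_M by blast
  have "1 = prob (\<Union>a\<in>P. a)" using Union_P prob_D by simp
  also have "\<dots> = (\<Sum>a\<in>P. prob a)"
    using P_sets P_disjoint finite_P
    by (intro finite_measure_finite_Union) (auto simp: disjoint_family_on_def sets_M)
  also have "\<dots> \<le> (\<Sum>a\<in>P. prob (K a) + \<eta> / card P)"
    using K(3) by (intro sum_mono) (fastforce simp: less_imp_le)
  also have "\<dots> = (\<Sum>a\<in>P. prob (K a)) + \<eta>" using N by (simp add: sum.distrib)
  also have "(\<Sum>a\<in>P. prob (K a)) = prob (\<Union>a\<in>P. K a)"
  proof (intro finite_measure_finite_Union[symmetric] finite_P)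
    show "K ` P \<subseteq> events" using Ks by blast
    show "disjoint_family_on K P"
      unfolding disjoint_family_on_def using P_disjoint K(2) by blast
  qed
  finally have "prob (UNIV - (\<Union>a\<in>P. K a)) \<le> \<eta>"
    using prob_compl[of "\<Union>a\<in>P. K a"] Ks finite_P by (simp add: sets.finite_UN)
  then show ?thesis using K by (intro exI[of _ K]) (auto simp: Compl_eq_Diff_UNIV)
qed

text \<open>
  Gibbs' inequality is applied to the following law on words: choose a word of guesses uniformly among
  those that occur, then keep each letter with probability \<open>1 - \<eta>\<close> and corrupt it otherwise.
\<close>

lemma part_entropy_le_guess:
  fixes G :: "real \<Rightarrow> real set"
  assumes S: "AE x in M. x \<in> S" and fS: "\<And>x. x \<in> S \<Longrightarrow> f x \<in> S"
    and GP: "\<And>x. x \<in> S \<Longrightarrow> G x \<in> P" and E: "E \<in> sets borel"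
    and guess: "\<And>x a. x \<in> S \<Longrightarrow> x \<notin> E \<Longrightarrow> a \<in> P \<Longrightarrow> x \<in> a \<Longrightarrow> G x = a"
    and \<eta>: "0 < \<eta>" "\<eta> < 1" and pE: "prob E \<le> \<eta>"
  shows "part_entropy M (cylinders f P n) \<le>
    ln (real (card (itinerary f G n ` S))) + real n * (- ln (1 - \<eta>) + \<eta> * ln (real (card P) / \<eta>))"
proof -
  define V where "V = itinerary f G n ` S"
  define N where "N = real (card P)"
  \<comment> \<open>The probability of reading \<open>a\<close> when \<open>g\<close> was guessed.
    Each of the \<open>N - 1\<close> wrong atoms gets \<open>\<eta> / N\<close>, so the total mass
    is at most one.\<close>
  define r where "r a g = (if a = g then 1 - \<eta> else \<eta> / N)" for a g :: "real set"
  define R where "R w v = (\<Prod>i<n. r (w ! i) (v ! i))" for w v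
  define q where "q w = (\<Sum>v\<in>V. R w v) / real (card V)" for w
  define b where "b = ln (N / \<eta>)"
  let ?p = "\<lambda>w. prob (word_cyl f w)"
  have "P \<noteq> {}" using Union_P prob_D by auto
  then have "card P > 0" using finite_P by (simp add: card_gt_0_iff)
  then have N: "N \<ge> 1" by (simp add: N_def)
  have Sn: "(f ^^ i) x \<in> S" if "x \<in> S" for x i using that fS by (induction i) auto
  have VP: "V \<subseteq> words P n" using GP Sn by (auto simp: V_def words_def itinerary_def)
  then have finV: "finite V" using finite_words[OF finite_P] finite_subset by blast
  have "S \<noteq> {}" using S by (auto simp: AE_False)
  then have "V \<noteq> {}" by (simp add: V_def)
  then have cV: "real (card V) \<ge> 1" using finV by (simp add: Suc_le_eq card_gt_0_iff)
  have r0: "r a g > 0" for a g using \<eta> N by (simp add: r_def)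
  have R0: "R w v > 0" for w v by (simp add: R_def r0 prod_pos)
  have q0: "q w > 0" for w
    unfolding q_def using cV finV \<open>V \<noteq> {}\<close> by (intro divide_pos_pos sum_pos R0) auto
  have rsum: "(\<Sum>a\<in>P. r a g) \<le> 1" if g: "g \<in> P" for g
  proof -
    have "(\<Sum>a\<in>P. r a g) = (\<Sum>a\<in>P - {g}. r a g) + r g g"
      using finite_P g by (simp add: sum.remove)
    also have "(\<Sum>a\<in>P - {g}. r a g) = (\<Sum>a\<in>P - {g}. \<eta> / N)"
      by (intro sum.cong) (auto simp: r_def)
    also have "\<dots> \<le> (\<Sum>a\<in>P. \<eta> / N)"
      using finite_P \<eta> N by (intro sum_mono2) auto
    also have "\<dots> = \<eta>" using N by (simp add: N_def)
    finally show ?thesis by (simp add: r_def)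
  qed
  have Rsum: "(\<Sum>w\<in>words P n. R w v) \<le> 1" if v: "v \<in> V" for v
  proof -
    have "v ! i \<in> P" if "i < n" for i using VP v that nth_mem[of i v] by (fastforce simp: words_def)
    then show ?thesis
      unfolding R_def sum_words_prod[OF finite_P, where h = "\<lambda>i a. r a (v ! i)"]
      by (intro prod_le_1) (auto intro!: rsum sum_nonneg less_imp_le[OF r0])
  qed
  have "sum q (words P n) = (\<Sum>v\<in>V. \<Sum>w\<in>words P n. R w v) / real (card V)"
    unfolding q_def sum_divide_distrib[symmetric] by (subst sum.swap) simp
  also have "\<dots> \<le> (\<Sum>v\<in>V. 1) / real (card V)"
    by (intro divide_right_mono sum_mono Rsum) auto
  also have "\<dots> = 1" using cV by simp
  finally have "part_entropy M (cylinders f P n) \<le> (\<Sum>w\<in>words P n. - ?p w * ln (q w))"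
    unfolding part_entropy_eq_words
    by (intro gibbs_inequality) (auto simp: finite_words finite_P q0 less_imp_le sum_prob_word_cyl)
  \<comment> \<open>A pointwise upper bound for \<open>- ln (q w)\<close> on the cylinder of
    \<open>w\<close>: the cost of naming the guess word, plus a small cost for each letter, plus
    \<open>b\<close> for each visit to \<open>E\<close>, outside of which guesses are right.\<close>
  define \<Phi> where "\<Phi> x = ln (real (card V)) + real n * - ln (1 - \<eta>) +
      b * (\<Sum>i<n. indicator ((f ^^ i) -` E) x)" for x :: real
  have b0: "b \<ge> 0" unfolding b_def using N \<eta> by (intro ln_ge_zero) (simp add: field_simps)
  have \<eta>0: "- ln (1 - \<eta>) \<ge> 0" using \<eta> by (simp add: ln_le_zero_iff)
  have bound: "- ln (q w) \<le> \<Phi> x" if w: "w \<in> words P n" and x: "x \<in> S" "x \<in> word_cyl f w" for w x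
  proof -
    define v where "v = itinerary f G n x"
    have v: "v \<in> V" using x by (simp add: v_def V_def)
    \<comment> \<open>In the mixture over all guess words, the summand of the word guessed along the
      orbit of \<open>x\<close> alone gives the bound.\<close>
    have "R w v \<le> (\<Sum>v\<in>V. R w v)"
      using finV v by (intro member_le_sum less_imp_le[OF R0]) auto
    then have "R w v / real (card V) \<le> q w" unfolding q_def by (intro divide_right_mono) auto
    then have "ln (R w v / real (card V)) \<le> ln (q w)"
      using R0[of w v] cV by (intro ln_mono) auto
    then have "- ln (q w) \<le> ln (real (card V)) - ln (R w v)"
      using R0[of w v] cV by (simp add: ln_div)
    also have "- ln (R w v) = (\<Sum>i<n. - ln (r (w ! i) (v ! i)))"
      unfolding R_def by (subst ln_prod) (auto simp: r0 sum_negf less_imp_neq[OF r0, symmetric])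
    then have "ln (real (card V)) - ln (R w v) = ln (real (card V)) + (\<Sum>i<n. - ln (r (w ! i) (v ! i)))"
      by simp
    also have "(\<Sum>i<n. - ln (r (w ! i) (v ! i))) \<le>
        (\<Sum>i<n. - ln (1 - \<eta>) + b * indicator ((f ^^ i) -` E) x)"
    proof (rule sum_mono)
      fix i assume i: "i \<in> {..<n}"
      have wi: "w ! i \<in> P" "(f ^^ i) x \<in> w ! i"
        using w x i by (auto simp: words_def word_cyl_def)
      have vi: "v ! i = G ((f ^^ i) x)" using i by (simp add: v_def itinerary_def)
      show "- ln (r (w ! i) (v ! i)) \<le> - ln (1 - \<eta>) + b * indicator ((f ^^ i) -` E) x"
      proof (cases "(f ^^ i) x \<in> E")
        case True
        have "- ln (\<eta> / N) = b" unfolding b_def using \<eta> N by (simp add: ln_div)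
        then show ?thesis using True \<eta>0 b0 by (simp add: r_def)
      next
        case False
        then have "w ! i = v ! i" using guess[OF Sn[OF x(1)] False wi] vi by simp
        then show ?thesis using False by (simp add: r_def)
      qed
    qed
    also have "\<dots> = real n * - ln (1 - \<eta>) + b * (\<Sum>i<n. indicator ((f ^^ i) -` E) x)"
      by (simp only: sum.distrib sum_distrib_left sum_constant card_lessThan)
    finally show ?thesis unfolding \<Phi>_def by simp
  qed
  have Ei: "(f ^^ i) -` E \<in> events" for i using funpow_vimage_sets[OF E] sets_M by simp
  have cyls: "word_cyl f w \<in> events" if "w \<in> words P n" for w
    using word_cyl_sets[OF that] sets_M by simp
  have ind: "integrable M (indicator A :: real \<Rightarrow> real)" if "A \<in> events" for A
    using that by (intro integrable_real_indicator) (auto simp: emeasure_eq_measure)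
  have int\<Phi>: "integrable M \<Phi>"
    unfolding \<Phi>_def by (intro Bochner_Integration.integrable_add integrable_mult_right
        Bochner_Integration.integrable_sum ind Ei) auto
  have "(\<Sum>w\<in>words P n. - ?p w * ln (q w)) = (\<Sum>w\<in>words P n. \<integral>x. indicator (word_cyl f w) x * - ln (q w) \<partial>M)"
    by (intro sum.cong refl) (simp add: cyls)
  also have "\<dots> \<le> (\<Sum>w\<in>words P n. \<integral>x. indicator (word_cyl f w) x * \<Phi> x \<partial>M)"
  proof (intro sum_mono integral_mono_AE)
    fix w assume w: "w \<in> words P n"
    show "integrable M (\<lambda>x. indicator (word_cyl f w) x * - ln (q w))"
      by (intro integrable_mult_left ind cyls w)
    show "integrable M (\<lambda>x. indicator (word_cyl f w) x * \<Phi> x)"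
      using integrable_mult_indicator[OF cyls[OF w] int\<Phi>] by simp
    show "AE x in M. indicator (word_cyl f w) x * - ln (q w) \<le> indicator (word_cyl f w) x * \<Phi> x"
      using S by eventually_elim (use bound[OF w] in \<open>auto simp: indicator_def\<close>)
  qed
  also have "\<dots> = (\<integral>x. (\<Sum>w\<in>words P n. indicator (word_cyl f w) x * \<Phi> x) \<partial>M)"
    using integrable_mult_indicator[OF cyls int\<Phi>]
    by (intro Bochner_Integration.integral_sum[symmetric]) simp
  also have "\<dots> = (\<integral>x. \<Phi> x \<partial>M)"
  proof (rule integral_cong_AE)
    have [measurable]: "\<Phi> \<in> borel_measurable M" using int\<Phi> by auto
    show "(\<lambda>x. \<Sum>w\<in>words P n. indicator (word_cyl f w) x * \<Phi> x) \<in> borel_measurable M"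
      using cyls by (intro borel_measurable_sum borel_measurable_times) auto
    show "\<Phi> \<in> borel_measurable M" by simp
    show "AE x in M. (\<Sum>w\<in>words P n. indicator (word_cyl f w) x * \<Phi> x) = \<Phi> x"
      using AE_funpow_D
    proof eventually_elim
      case (elim x)
      from word_cyl_exists[OF this, of n] obtain w where w: "w \<in> words P n" "x \<in> word_cyl f w"
        by blast
      have "(\<Sum>u\<in>words P n. indicator (word_cyl f u) x * \<Phi> x) = (\<Sum>u\<in>words P n. if u = w then \<Phi> x else 0)"
      proof (intro sum.cong refl)
        fix u assume u: "u \<in> words P n"
        show "indicator (word_cyl f u) x * \<Phi> x = (if u = w then \<Phi> x else 0)"
          using w word_cyl_disjoint[OF u w(1) _ w(2)] by (cases "x \<in> word_cyl f u") auto
      qed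
      then show ?case using w finite_words[OF finite_P] by simp
    qed
  qed
  also have "\<dots> = ln (real (card V)) + real n * - ln (1 - \<eta>) + b * (\<Sum>i<n. prob ((f ^^ i) -` E))"
    unfolding \<Phi>_def
    by (subst Bochner_Integration.integral_add)
       (auto intro!: integrable_mult_right Bochner_Integration.integrable_sum ind Ei
         simp: Ei Bochner_Integration.integral_sum ind prob_space[simplified])
  also have "(\<Sum>i<n. prob ((f ^^ i) -` E)) = real n * prob E"
    using inv_funpow[OF E] by simp
  also have "b * (real n * prob E) \<le> b * (real n * \<eta>)"
    using b0 pE by (intro mult_left_mono) auto
  finally have "(\<Sum>w\<in>words P n. - ?p w * ln (q w)) \<le>
      ln (real (card V)) + real n * - ln (1 - \<eta>) + b * (real n * \<eta>)" by simp
  with \<open>part_entropy M (cylinders f P n) \<le> (\<Sum>w\<in>words P n. - ?p w * ln (q w))\<close>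
  show ?thesis by (simp add: V_def b_def N_def algebra_simps)
qed

text \<open>The compact pieces of the atoms lie at positive distance, so \<open>m\<close> symbols of
  the coding predict the atom off a set of measure at most \<open>\<eta>\<close>. Guess words of
  length \<open>n\<close> are then functions of itineraries of length \<open>n + m\<close>, which
  bounds their number by \<open>C * B ^ (n + m)\<close>. The cost of wrong guesses vanishes as
  \<open>\<eta>\<close> tends to zero.\<close>

lemma entropy_wrt_le:
  fixes s :: "real \<Rightarrow> 'b" and B C :: real
  assumes S: "AE x in M. x \<in> S" and fS: "\<And>x. x \<in> S \<Longrightarrow> f x \<in> S"
    and fin: "\<And>n. finite (itinerary f s n ` S)"
    and count: "\<And>n. real (card (itinerary f s n ` S)) \<le> C * B ^ n" and B: "B > 0" and C: "C > 0"
    and sep: "\<And>r. r > 0 \<Longrightarrow>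
      \<exists>m. \<forall>x\<in>S. \<forall>y\<in>S. itinerary f s m x = itinerary f s m y \<longrightarrow> dist x y < r"
  shows "entropy_wrt M f P \<le> ln B"
proof -
  have "P \<noteq> {}" using Union_P prob_D by auto
  then have "card P > 0" using finite_P by (simp add: card_gt_0_iff)
  have "S \<noteq> {}" using S by (auto simp: AE_False)
  have le: "entropy_wrt M f P \<le> ln B + (- ln (1 - \<eta>) + \<eta> * ln (real (card P) / \<eta>))"
    if \<eta>: "0 < \<eta>" "\<eta> < 1" for \<eta>
  proof -
    obtain K where K: "\<And>a. a \<in> P \<Longrightarrow> compact (K a)" "\<And>a. a \<in> P \<Longrightarrow> K a \<subseteq> a"
      "prob (- (\<Union>a\<in>P. K a)) \<le> \<eta>"
      using compact_approximation[OF \<eta>(1)] by blast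
    define E where "E = - (\<Union>a\<in>P. K a)"
    have E: "E \<in> sets borel"
      unfolding E_def using K(1) finite_P by (intro borel_open open_Compl compact_imp_closed compact_UN) auto
    have "\<forall>\<^sub>F r in at_right 0. \<forall>a\<in>P. \<forall>b\<in>P. a \<noteq> b \<longrightarrow> (\<forall>x\<in>K a. \<forall>y\<in>K b. r \<le> dist x y)"
    proof (intro eventually_ball_finite finite_P ballI)
      fix a b assume ab: "a \<in> P" "b \<in> P"
      show "\<forall>\<^sub>F r in at_right 0. a \<noteq> b \<longrightarrow> (\<forall>x\<in>K a. \<forall>y\<in>K b. r \<le> dist x y)"
      proof (cases "a = b")
        case False
        then have "K a \<inter> K b = {}" using K(2) ab P_disjoint by blast
        then obtain \<delta> where "\<delta> > 0" "\<forall>x\<in>K a. \<forall>y\<in>K b. \<delta> \<le> dist x y"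
          using separate_compact_closed[of "K a" "K b"] K(1) ab compact_imp_closed by blast
        then show ?thesis
          unfolding eventually_at_right_field by (intro exI[of _ \<delta>]) force
      qed simp
    qed
    moreover have "\<forall>\<^sub>F r in at_right (0::real). r > 0" by (rule eventually_at_right_less)
    ultimately have "\<forall>\<^sub>F r in at_right 0. r > 0 \<and>
        (\<forall>a\<in>P. \<forall>b\<in>P. a \<noteq> b \<longrightarrow> (\<forall>x\<in>K a. \<forall>y\<in>K b. r \<le> dist x y))"
      by eventually_elim simp
    from eventually_happens'[OF trivial_limit_at_right_real this] obtain r where r0: "r > 0 \<and>
        (\<forall>a\<in>P. \<forall>b\<in>P. a \<noteq> b \<longrightarrow> (\<forall>x\<in>K a. \<forall>y\<in>K b. r \<le> dist x y))"
      by (rule exE)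
    then have r: "r > 0"
      "\<And>a b x y. \<lbrakk>a \<in> P; b \<in> P; a \<noteq> b; x \<in> K a; y \<in> K b\<rbrakk> \<Longrightarrow> r \<le> dist x y"
      by simp_all
    obtain m where m: "\<And>x y. \<lbrakk>x \<in> S; y \<in> S; itinerary f s m x = itinerary f s m y\<rbrakk> \<Longrightarrow> dist x y < r"
      using sep[OF r(1)] by blast
    \<comment> \<open>An atom whose compact piece contains a surviving point with the window
      \<open>v\<close>, if there is one, and any atom otherwise. Two pieces cannot both qualify, as
      points of \<open>S\<close> with equal windows are closer than \<open>r\<close>.\<close>
    define \<gamma> where "\<gamma> v = (SOME a. a \<in> P \<and>
        ((\<exists>b\<in>P. \<exists>y\<in>S \<inter> K b. itinerary f s m y = v) \<longrightarrow> (\<exists>y\<in>S \<inter> K a. itinerary f s m y = v)))" for v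
    have \<gamma>: "\<gamma> v \<in> P \<and>
        ((\<exists>b\<in>P. \<exists>y\<in>S \<inter> K b. itinerary f s m y = v) \<longrightarrow> (\<exists>y\<in>S \<inter> K (\<gamma> v). itinerary f s m y = v))" for v
      unfolding \<gamma>_def by (rule someI_ex) (use \<open>P \<noteq> {}\<close> in blast)
    define G where "G x = \<gamma> (itinerary f s m x)" for x
    have guess: "G x = a" if x: "x \<in> S" "x \<notin> E" "a \<in> P" "x \<in> a" for x a
    proof (rule ccontr)
      assume ne: "G x \<noteq> a"
      from x obtain a' where "a' \<in> P" "x \<in> K a'" by (auto simp: E_def)
      then have xK: "x \<in> K a" using P_disjoint[of a a' x] K(2) x by blast
      then obtain y where y: "y \<in> S" "y \<in> K (G x)" "itinerary f s m y = itinerary f s m x"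
        using \<gamma>[of "itinerary f s m x"] x by (auto simp: G_def)
      have "r \<le> dist x y" using r(2)[OF x(3) _ _ xK y(2)] ne \<gamma> by (auto simp: G_def)
      moreover have "dist x y < r" using m[OF x(1) y(1)] y(3) by simp
      ultimately show False by simp
    qed
    let ?c = "- ln (1 - \<eta>) + \<eta> * ln (real (card P) / \<eta>)"
    have bound: "part_entropy M (cylinders f P n) \<le> ln C + real (n + m) * ln B + real n * ?c" for n
    proof -
      let ?I = "itinerary f s (n + m) ` S"
      have img: "itinerary f G n ` S = (\<lambda>v. map (\<lambda>i. \<gamma> (take m (drop i v))) [0..<n]) ` ?I"
        unfolding image_image
        by (intro image_cong refl) (auto simp: itinerary_def[of f G] G_def itinerary_funpow[where n = "n + m"])
      have "card (itinerary f G n ` S) \<le> card ?I" unfolding img by (rule card_image_le[OF fin])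
      then have "real (card (itinerary f G n ` S)) \<le> C * B ^ (n + m)"
        using count[of "n + m"] by linarith
      moreover have "card (itinerary f G n ` S) > 0"
        using \<open>S \<noteq> {}\<close> fin[of "n + m"] unfolding img by (simp add: card_gt_0_iff)
      ultimately have "ln (real (card (itinerary f G n ` S))) \<le> ln (C * B ^ (n + m))"
        by (intro ln_mono) auto
      moreover have "ln (C * B ^ (n + m)) = ln C + real (n + m) * ln B"
        using B C by (simp add: ln_mult ln_realpow)
      moreover have "part_entropy M (cylinders f P n) \<le>
          ln (real (card (itinerary f G n ` S))) + real n * ?c"
      proof (rule part_entropy_le_guess[OF S fS _ E _ \<eta> K(3)[folded E_def]])
        show "G x \<in> P" for x using \<gamma> by (simp add: G_def)
      qed (use guess in auto)
      ultimately show ?thesis by linarith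
    qed
    have "(\<lambda>n. ln C * (1 / real n) + (1 + real m * (1 / real n)) * ln B + ?c) \<longlonglongrightarrow>
        ln C * 0 + (1 + real m * 0) * ln B + ?c"
      by (intro tendsto_intros lim_1_over_n)
    then have "entropy_wrt M f P \<le> ln C * 0 + (1 + real m * 0) * ln B + ?c"
    proof (rule LIMSEQ_le[OF entropy_wrt_LIMSEQ], intro exI[of _ 1] allI impI)
      fix n :: nat assume n: "n \<ge> 1"
      have split: "(x + real (n + m) * y + real n * z) / real n = x * (1 / real n) + (1 + real m * (1 / real n)) * y + z"
        for x y z :: real using n by (simp add: field_simps)
      have "part_entropy M (cylinders f P n) / real n \<le> (ln C + real (n + m) * ln B + real n * ?c) / real n"
        by (intro divide_right_mono bound) simp
      also have "\<dots> = ln C * (1 / real n) + (1 + real m * (1 / real n)) * ln B + ?c"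
        by (rule split)
      finally show "part_entropy M (cylinders f P n) / real n \<le>
        ln C * (1 / real n) + (1 + real m * (1 / real n)) * ln B + ?c" .
    qed
    then show ?thesis by simp
  qed
  have "((\<lambda>\<eta>. ln B + (- ln (1 - \<eta>) + (ln (real (card P)) * \<eta> - \<eta> * ln \<eta>))) \<longlongrightarrow>
      ln B + (- ln (1 - 0) + (ln (real (card P)) * 0 - 0))) (at_right 0)"
    by (intro tendsto_intros x_ln_x_tendsto_0) auto
  then have "entropy_wrt M f P \<le> ln B + (- ln (1 - 0) + (ln (real (card P)) * 0 - 0))"
  proof (rule tendsto_lowerbound)
    have "\<forall>\<^sub>F \<eta> in at_right (0::real). 0 < \<eta> \<and> \<eta> < 1"
      unfolding eventually_at_right_field by (intro exI[of _ 1]) auto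
    then show "\<forall>\<^sub>F \<eta> in at_right 0. entropy_wrt M f P \<le>
        ln B + (- ln (1 - \<eta>) + (ln (real (card P)) * \<eta> - \<eta> * ln \<eta>))"
    proof eventually_elim
      case (elim \<eta>)
      then show ?case using le[of \<eta>] \<open>card P > 0\<close> by (simp add: ln_div algebra_simps)
    qed
  qed simp
  then show ?thesis by simp
qed

end

section \<open>The maps\<close>

text \<open>
  \<open>drop_gap k\<close> is the number \<open>\<delta>\<^sub>k\<close>; for \<open>k \<ge> 1\<close> it solves \<open>4 - 2\<^bsup>k+1\<^esup> \<delta>\<^sub>k = - 2\<^bsup>-k\<^esup>\<close>, that is, the
  orbit of \<open>0\<close> returns to the left end of the interval of radius \<open>2\<^bsup>-k\<^esup>\<close> after \<open>k + 2\<close> steps.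
\<close>

definition drop_gap :: "nat \<Rightarrow> real" where
  "drop_gap k = (if k = 0 then 0 else (4 + (1/2) ^ k) / 2 ^ Suc k)"

text \<open>Only \<open>x \<le> 1\<close> sees \<open>k\<close>, so the doubling map and the
  expansion around 4 are common to all maps. The case distinctions are made at points outside the
  domain.\<close>

definition branch_map :: "nat \<Rightarrow> real \<Rightarrow> real" where
  "branch_map k x =
    (if x \<le> 1 then 4 - drop_gap k + x\<^sup>2
     else if x < 5 then 2 * x - 4
     else if x < 13/2 then 2 * x - 6
     else 2 * x - 7)"

text \<open>The ends of the third branch are mapped to -3/2 and 9/2, and the limit map sends -1 and
  1 to 5; all three images lie off the closure of the domain. Open branches leave out the ends, in
  particular 0 and 13/2.\<close>

definition branch :: "nat \<Rightarrow> real set" where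
  "branch j = [{-1<..<0}, {0<..<1}, {5/4<..<17/4}, {6<..<13/2}, {13/2<..<7}] ! j"

lemma lessThan_5: "{..<5} = {0, 1, 2, 3, 4 :: nat}"
  by (simp add: lessThan_Suc numeral_eq_Suc insert_commute)

lemma all_lt_5: "(\<forall>j<5. Q (j::nat)) \<longleftrightarrow> Q 0 \<and> Q 1 \<and> Q 2 \<and> Q 3 \<and> Q 4"
  by (auto simp: numeral_eq_Suc less_Suc_eq)

lemma branch_simps [simp]:
  "branch 0 = {-1<..<0}" "branch 1 = {0<..<1}" "branch (Suc 0) = {0<..<1}" "branch 2 = {5/4<..<17/4}"
  "branch 3 = {6<..<13/2}" "branch 4 = {13/2<..<7}"
  by (simp_all add: branch_def numeral_eq_Suc)

lemma pm_dom_branch: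
  "pm_dom 5 branch = {-1<..<0} \<union> {0<..<1} \<union> {5/4<..<17/4} \<union> {6<..<13/2} \<union> {13/2<..<7}"
  unfolding pm_dom_def lessThan_5 by (simp add: Un_assoc)

lemma pm_ends_branch: "pm_ends 5 branch = {-1, 0, 1, 5/4, 17/4, 6, 13/2, 7}"
proof -
  have "frontier {a<..<b} = {a, b}" if "a < b" for a b :: real
    using that by (auto simp: frontier_def)
  then show ?thesis unfolding pm_ends_def lessThan_5 by auto
qed

lemma drop_gap_0 [simp]: "drop_gap 0 = 0"
  by (simp add: drop_gap_def)

lemma drop_gap_bounds: "0 \<le> drop_gap k" "drop_gap k \<le> 5 / 2 ^ Suc k" "drop_gap k \<le> 5 / 4"
proof -
  show "0 \<le> drop_gap k" by (simp add: drop_gap_def)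
  show *: "drop_gap k \<le> 5 / 2 ^ Suc k"
    unfolding drop_gap_def using power_le_one[of "1/2::real" k] by (auto simp: divide_right_mono)
  show "drop_gap k \<le> 5 / 4"
  proof (cases "k = 0")
    case False
    then have "(2::real) ^ 2 \<le> 2 ^ Suc k" by (intro power_increasing) auto
    then have "5 / 2 ^ Suc k \<le> (5::real) / 4" by (intro divide_left_mono) auto
    with * show ?thesis by linarith
  qed simp
qed

lemma drop_gap_tendsto_0: "drop_gap \<longlonglongrightarrow> 0"
proof (rule tendsto_sandwich[of "\<lambda>_. 0" _ _ "\<lambda>k. 5 / 2 ^ Suc k"])
  have "(\<lambda>k. 5 * (1/2) ^ Suc k :: real) \<longlonglongrightarrow> 5 * 0"
    by (intro tendsto_intros LIMSEQ_Suc LIMSEQ_power_zero) simp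
  then show "(\<lambda>k. 5 / 2 ^ Suc k :: real) \<longlonglongrightarrow> 0" by (simp add: power_one_over field_simps)
  show "\<forall>\<^sub>F k in sequentially. 0 \<le> drop_gap k" "\<forall>\<^sub>F k in sequentially. drop_gap k \<le> 5 / 2 ^ Suc k"
    using drop_gap_bounds by simp_all
qed simp

lemma branch_map_eq:
  "x \<le> 1 \<Longrightarrow> branch_map k x = 4 - drop_gap k + x\<^sup>2"
  "1 < x \<Longrightarrow> x < 5 \<Longrightarrow> branch_map k x = 2 * x - 4"
  "5 \<le> x \<Longrightarrow> x < 13/2 \<Longrightarrow> branch_map k x = 2 * x - 6"
  "13/2 \<le> x \<Longrightarrow> branch_map k x = 2 * x - 7"
  by (simp_all add: branch_map_def)

section \<open>Derivatives and monotonicity of the branches\<close>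

definition branch_slope :: "real \<Rightarrow> real" where
  "branch_slope x = (if x \<le> 1 then 2 * x else 2)"

lemma branch_map_has_derivative:
  assumes "x \<in> pm_dom 5 branch"
  shows "(branch_map k has_real_derivative branch_slope x) (at x)"
proof -
  consider "x < 1" | "1 < x" "x < 5" | "5 < x" "x < 13/2" | "13/2 < x"
    using assms by (auto simp: pm_dom_branch)
  then show ?thesis
  proof cases
    case 1
    have "((\<lambda>x. 4 - drop_gap k + x\<^sup>2) has_real_derivative branch_slope x) (at x)"
      using 1 by (auto intro!: derivative_eq_intros simp: branch_slope_def)
    then show ?thesis
      by (rule has_field_derivative_transform_within_open[of _ _ _ "{..<1}"]) (use 1 in \<open>auto simp: branch_map_eq\<close>)
  next
    case 2
    have "((\<lambda>x. 2 * x - 4) has_real_derivative branch_slope x) (at x)"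
      using 2 by (auto intro!: derivative_eq_intros simp: branch_slope_def)
    then show ?thesis
      by (rule has_field_derivative_transform_within_open[of _ _ _ "{1<..<5}"]) (use 2 in \<open>auto simp: branch_map_eq\<close>)
  next
    case 3
    have "((\<lambda>x. 2 * x - 6) has_real_derivative branch_slope x) (at x)"
      using 3 by (auto intro!: derivative_eq_intros simp: branch_slope_def)
    then show ?thesis
      by (rule has_field_derivative_transform_within_open[of _ _ _ "{5<..<13/2}"]) (use 3 in \<open>auto simp: branch_map_eq\<close>)
  next
    case 4
    have "((\<lambda>x. 2 * x - 7) has_real_derivative branch_slope x) (at x)"
      using 4 by (auto intro!: derivative_eq_intros simp: branch_slope_def)
    then show ?thesis
      by (rule has_field_derivative_transform_within_open[of _ _ _ "{13/2<..}"]) (use 4 in \<open>auto simp: branch_map_eq\<close>)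
  qed
qed

lemma branch_subset_dom: "j < 5 \<Longrightarrow> branch j \<subseteq> pm_dom 5 branch"
  by (auto simp: pm_dom_def)

lemma open_branch: "j < 5 \<Longrightarrow> open (branch j)"
proof -
  have "\<forall>j<5. open (branch j)" unfolding all_lt_5 by simp
  then show "j < 5 \<Longrightarrow> open (branch j)" by simp
qed

lemma interior_branch: "j < 5 \<Longrightarrow> interior (branch j) = branch j"
  by (simp add: open_branch interior_open)

lemma branch_map_strict_mono:
  "\<forall>j<5. strict_mono_on (branch j) (branch_map k) \<or> strict_mono_on (branch j) (\<lambda>x. - branch_map k x)"
proof -
  have sq: "x * x < y * y" if "0 < x" "x < y" for x y :: real
    using that by (intro mult_strict_mono) auto
  have "strict_mono_on {-1<..<0} (\<lambda>x. - branch_map k x)"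
  proof (rule strict_mono_onI)
    fix x y :: real assume "x \<in> {-1<..<0}" "y \<in> {-1<..<0}" "x < y"
    then show "- branch_map k x < - branch_map k y"
      using sq[of "- y" "- x"] by (simp add: branch_map_eq power2_eq_square)
  qed
  moreover have "strict_mono_on {0<..<1} (branch_map k)"
  proof (rule strict_mono_onI)
    fix x y :: real assume "x \<in> {0<..<1}" "y \<in> {0<..<1}" "x < y"
    then show "branch_map k x < branch_map k y"
      using sq[of x y] by (simp add: branch_map_eq power2_eq_square)
  qed
  moreover have "strict_mono_on {5/4<..<17/4} (branch_map k)" "strict_mono_on {6<..<13/2} (branch_map k)"
    "strict_mono_on {13/2<..<7} (branch_map k)"
    by (auto intro!: strict_mono_onI simp: branch_map_eq)
  ultimately show ?thesis unfolding all_lt_5 by simp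
qed

text \<open>The interval reaches down to -2 to contain the image of the third branch, which extends
  to -3/2. The quadratic branches have values between 4 - 5/4 and 5.\<close>

lemma pm_map_branch: "pm_map {-2..7} 5 (branch_map k) branch"
  unfolding pm_map_def
proof (intro conjI)
  have wit: "\<exists>u v. u < v \<and> u \<in> {a<..<b} \<and> v \<in> {a<..<b}" if "a < b" for a b :: real
    using that by (intro exI[of _ "(2 * a + b) / 3"] exI[of _ "(a + 2 * b) / 3"]) (auto simp: field_simps)
  show "\<forall>j<5. is_interval (branch j) \<and> branch j \<subseteq> {-2..7} \<and> (\<exists>x y. x < y \<and> x \<in> branch j \<and> y \<in> branch j)"
    unfolding all_lt_5 using wit[of "-1" 0] wit[of 0 1] wit[of "5/4" "17/4"] wit[of 6 "13/2"] wit[of "13/2" 7]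
    by (simp add: is_interval_oo subset_iff)
  show "\<forall>i<5. \<forall>j<5. i \<noteq> j \<longrightarrow> branch i \<inter> branch j = {}"
    unfolding all_lt_5 by auto
  have "continuous_on (branch j) (branch_map k)" if "j < 5" for j
    using branch_subset_dom[OF that] branch_map_has_derivative DERIV_isCont
    by (intro continuous_at_imp_continuous_on) blast
  moreover have "branch_map k ` branch j \<subseteq> {-2..7}" if j: "j < 5" for j
  proof
    fix y assume "y \<in> branch_map k ` branch j"
    then obtain x where x: "x \<in> pm_dom 5 branch" "y = branch_map k x" using branch_subset_dom[OF j] by blast
    have "x * x \<le> 1" if "-1 < x" "x < 1" using that by (simp add: power2_eq_square[symmetric] abs_square_le_1)
    moreover have "0 \<le> 6 + (x * x - drop_gap k)"
      using drop_gap_bounds(3)[of k] zero_le_square[of x] by linarith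
    ultimately show "y \<in> {-2..7}"
      using x drop_gap_bounds(1)[of k]
      by (auto simp: pm_dom_branch branch_map_eq power2_eq_square)
  qed
  ultimately show "\<forall>j<5. branch_map k ` branch j \<subseteq> {-2..7} \<and> continuous_on (branch j) (branch_map k) \<and>
      (strict_mono_on (branch j) (branch_map k) \<or> strict_mono_on (branch j) (\<lambda>x. - branch_map k x))"
    using branch_map_strict_mono by blast
qed (auto simp: is_interval_cc)

lemma deriv_branch_map: "x \<in> pm_dom 5 branch \<Longrightarrow> deriv (branch_map k) x = branch_slope x"
  by (rule DERIV_imp_deriv[OF branch_map_has_derivative])

lemma C2_diffeo_branch:
  assumes "j < 5"
  shows "C2_diffeo_on (branch j) (branch_map k)"
proof -
  \<comment> \<open>The second derivative; its jump at 1 is outside the domain.\<close>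
  define g :: "real \<Rightarrow> real" where "g x = (if x \<le> 1 then 2 else 0)" for x
  have "inj_on (branch_map k) (branch j)" if "strict_mono_on (branch j) (\<lambda>x. - branch_map k x)"
    using strict_mono_on_imp_inj_on[OF that] by (auto simp: inj_on_def)
  then have inj: "inj_on (branch_map k) (branch j)"
    using branch_map_strict_mono assms strict_mono_on_imp_inj_on by blast
  have "(branch_map k has_real_derivative branch_slope x) (at x) \<and>
      (branch_slope has_real_derivative g x) (at x) \<and> isCont g x \<and> branch_slope x \<noteq> 0"
    if "x \<in> branch j" for x
  proof -
    from that have x: "x \<in> pm_dom 5 branch" using branch_subset_dom[OF assms] by blast
    have "(branch_slope has_real_derivative g x) (at x) \<and> isCont g x"
    proof (cases "x < 1")
      case True
      have "((\<lambda>x. 2 * x) has_real_derivative 2) (at x)" by (auto intro!: derivative_eq_intros)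
      then have "(branch_slope has_real_derivative 2) (at x)"
        by (rule has_field_derivative_transform_within_open[of _ _ _ "{..<1}"])
           (use True in \<open>auto simp: branch_slope_def\<close>)
      moreover have "continuous_on {..<1} g"
        by (rule continuous_on_eq[of _ "\<lambda>_. 2"]) (auto simp: g_def)
      ultimately show ?thesis using True by (simp add: g_def[of x] continuous_on_eq_continuous_at)
    next
      case False
      then have gt: "x > 1" using x by (auto simp: pm_dom_branch)
      have "((\<lambda>x. 2) has_real_derivative 0) (at x)" by simp
      then have "(branch_slope has_real_derivative 0) (at x)"
        by (rule has_field_derivative_transform_within_open[of _ _ _ "{1<..}"])
           (use gt in \<open>auto simp: branch_slope_def\<close>)
      moreover have "continuous_on {1<..} g"
        by (rule continuous_on_eq[of _ "\<lambda>_. 0"]) (auto simp: g_def)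
      ultimately show ?thesis using gt by (simp add: g_def[of x] continuous_on_eq_continuous_at)
    qed
    then show ?thesis
      using branch_map_has_derivative[OF x] x by (auto simp: branch_slope_def pm_dom_branch)
  qed
  with inj show ?thesis unfolding C2_diffeo_on_def by blast
qed

section \<open>Convexity condition and uniform convergence\<close>

lemma convex_on_transform:
  assumes f: "convex_on C f" and eq: "\<And>x. x \<in> C \<Longrightarrow> f x = g x"
  shows "convex_on C g"
  unfolding convex_on_def
proof (intro conjI ballI allI impI)
  show C: "convex C" using f by (simp add: convex_on_def)
  fix x y u v assume "x \<in> C" "y \<in> C" "0 \<le> u" "0 \<le> v" "u + v = (1::real)"
  moreover from this have "u *\<^sub>R x + v *\<^sub>R y \<in> C" using convexD[OF C] by blast
  moreover have "f (u *\<^sub>R x + v *\<^sub>R y) \<le> u * f x + v * f y"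
    using f calculation unfolding convex_on_def by blast
  ultimately show "g (u *\<^sub>R x + v *\<^sub>R y) \<le> u * g x + v * g y"
    by (simp add: eq)
qed

text \<open>The second derivative of \<open>(c * x) powr (- 1 / 2)\<close> is nonnegative. The sign
  of \<open>c\<close> is free so that \<open>c = -2\<close> and \<open>c = 2\<close> cover the two
  quadratic branches, where the slope has opposite signs.\<close>

lemma convex_on_inverse_sqrt:
  fixes c :: real
  assumes "convex C" and pos: "\<And>x. x \<in> C \<Longrightarrow> 0 < c * x"
  shows "convex_on C (\<lambda>x. 1 / sqrt \<bar>c * x\<bar>)"
proof -
  have "convex_on C (\<lambda>x. (c * x) powr (- 1 / 2))"
  proof (rule f''_ge0_imp_convex[OF \<open>convex C\<close>,
        where f' = "\<lambda>x. c * (- 1 / 2 * (c * x) powr (- 3 / 2))" and f'' = "\<lambda>x. c\<^sup>2 * (3 / 4 * (c * x) powr (- 5 / 2))"])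
    fix x assume "x \<in> C"
    note p = pos[OF this]
    show "((\<lambda>x. (c * x) powr (- 1 / 2)) has_real_derivative c * (- 1 / 2 * (c * x) powr (- 3 / 2))) (at x)"
      by (rule DERIV_cong[OF DERIV_fun_powr[of "\<lambda>x. c * x" c]]) (use p in \<open>auto intro!: derivative_eq_intros\<close>)
    have "((\<lambda>x. (c * x) powr (- 3 / 2)) has_real_derivative c * (- 3 / 2 * (c * x) powr (- 5 / 2))) (at x)"
      by (rule DERIV_cong[OF DERIV_fun_powr[of "\<lambda>x. c * x" c]]) (use p in \<open>auto intro!: derivative_eq_intros\<close>)
    then have "((\<lambda>x. c * (- 1 / 2 * (c * x) powr (- 3 / 2))) has_real_derivative
        c * (- 1 / 2 * (c * (- 3 / 2 * (c * x) powr (- 5 / 2))))) (at x)"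
      by (intro DERIV_cmult)
    then show "((\<lambda>x. c * (- 1 / 2 * (c * x) powr (- 3 / 2))) has_real_derivative
        c\<^sup>2 * (3 / 4 * (c * x) powr (- 5 / 2))) (at x)"
      by (rule DERIV_cong) (simp add: power2_eq_square)
  qed simp
  then show ?thesis
  proof (rule convex_on_transform)
    show "(c * x) powr (- 1 / 2) = 1 / sqrt \<bar>c * x\<bar>" if "x \<in> C" for x
      using pos[OF that] by (simp add: powr_minus_divide powr_half_sqrt)
  qed
qed

lemma NSD_family_branch: "NSD_family {-2..7} 5 branch_map (\<lambda>_. branch)"
  unfolding NSD_family_def
proof (intro conjI allI impI)
  fix k j :: nat
  assume j: "j < 5"
  show "C2_diffeo_on (interior (branch j)) (branch_map k)"
    using C2_diffeo_branch[OF j] interior_branch[OF j] by simp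
  have "\<forall>j<5. convex_on (branch j) (\<lambda>x. 1 / sqrt \<bar>branch_slope x\<bar>)"
  proof -
    have "convex_on {-1<..<0} (\<lambda>x. 1 / sqrt \<bar>branch_slope x\<bar>)"
      by (rule convex_on_transform[OF convex_on_inverse_sqrt[of _ "-2"]]) (auto simp: branch_slope_def)
    moreover have "convex_on {0<..<1} (\<lambda>x. 1 / sqrt \<bar>branch_slope x\<bar>)"
      by (rule convex_on_transform[OF convex_on_inverse_sqrt[of _ 2]]) (auto simp: branch_slope_def)
    moreover have "convex_on {a<..<b} (\<lambda>x. 1 / sqrt \<bar>branch_slope x\<bar>)" if "1 < a" for a b
      by (rule convex_on_transform[of _ "\<lambda>x. 1 / sqrt \<bar>2\<bar>"])
         (use that in \<open>auto simp: branch_slope_def convex_on_const\<close>)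
    ultimately show ?thesis unfolding all_lt_5 by simp
  qed
  then have "convex_on (branch j) (\<lambda>x. 1 / sqrt \<bar>branch_slope x\<bar>)" using j by simp
  then show "convex_on (interior (branch j)) (\<lambda>x. 1 / sqrt \<bar>deriv (branch_map k) x\<bar>)"
    unfolding interior_branch[OF j]
    by (rule convex_on_transform) (use deriv_branch_map branch_subset_dom[OF j] in \<open>auto simp: subset_iff\<close>)
next
  show "\<exists>M. \<forall>k. \<forall>j<5. \<forall>x\<in>interior (branch j). \<bar>deriv (branch_map k) x\<bar> \<le> M"
  proof (intro exI[of _ 2] allI impI ballI)
    fix k j x assume "j < 5" "x \<in> interior (branch j)"
    then have "x \<in> pm_dom 5 branch" using branch_subset_dom interior_branch by blast
    then show "\<bar>deriv (branch_map k) x\<bar> \<le> 2"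
      unfolding deriv_branch_map[OF \<open>x \<in> pm_dom 5 branch\<close>] by (auto simp: branch_slope_def pm_dom_branch)
  qed
qed (rule pm_map_branch)

text \<open>All maps have the same branches, so the identity serves as conjugacy, and the uniform
  distance to the limit map is at most \<open>drop_gap k\<close>.\<close>

lemma pm_conv_via_branch: "pm_conv_via {-2..7} 5 branch_map (\<lambda>_. branch) (\<lambda>_. id) (\<lambda>_. id)"
  unfolding pm_conv_via_def
proof (intro conjI)
  show "\<forall>k\<ge>1. homeomorphism {-2..7::real} {-2..7} id id \<and> (\<forall>j<5. id ` branch j = branch j)"
    by (simp add: homeomorphism_def)
  show "uniform_limit (pm_dom 5 branch) (\<lambda>k x. id (branch_map k (id x))) (branch_map 0) sequentially"
  proof (rule uniform_limitI)
    fix e :: real assume "e > 0"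
    then have "\<forall>\<^sub>F k in sequentially. drop_gap k < e"
      using order_tendstoD(2)[OF drop_gap_tendsto_0] by blast
    then show "\<forall>\<^sub>F k in sequentially. \<forall>x\<in>pm_dom 5 branch. dist (id (branch_map k (id x))) (branch_map 0 x) < e"
    proof eventually_elim
      case (elim k)
      then show ?case using \<open>e > 0\<close> drop_gap_bounds(1)[of k]
        by (auto simp: branch_map_def dist_real_def)
    qed
  qed
  show "uniform_limit {-2..7::real} (\<lambda>_. id) id sequentially" by (rule uniform_limit_const)
qed

section \<open>Critical relations of the limit map\<close>

lemma eventually_at_right_0I:
  "(\<And>e. 0 < e \<Longrightarrow> e < 1/8 \<Longrightarrow> Q e) \<Longrightarrow> eventually Q (at_right (0::real))"
  \<comment> \<open>Every branch, and every gap of positive length between branches, is longer than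
    1/8, so within this distance one side of an endpoint lies in a single branch or gap.\<close>
  unfolding eventually_at_right_field by (intro exI[of _ "1/8"]) auto

lemma no_pm_hits_outside:
  assumes "eventually (\<lambda>e. c + \<sigma> * e \<notin> pm_dom d J) (at_right 0)" "m \<ge> 1"
  shows "\<not> pm_hits d f J c \<sigma> m c'"
proof
  assume "pm_hits d f J c \<sigma> m c'"
  then have "eventually (\<lambda>e. \<forall>i<m. (f ^^ i) (c + \<sigma> * e) \<in> pm_dom d J) (at_right 0)"
    by (simp add: pm_hits_def)
  with assms(1) have "eventually (\<lambda>e. False) (at_right (0::real))"
  proof eventually_elim
    case (elim e)
    then show ?case using elim(2)[rule_format, of 0] assms(2) by simp
  qed
  then show False by simp
qed

text \<open>A relation of order one would have to end in \<open>l\<close>, which is no endpoint, and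
  a longer one would need orbits that are still in the domain after one step, when they are already
  in \<open>H\<close>.\<close>

lemma no_pm_hits_escape:
  assumes lim: "((\<lambda>e. f (c + \<sigma> * e)) \<longlongrightarrow> l) (at_right 0)"
    and H: "open H" "l \<in> H" "H \<inter> pm_dom d J = {}" "H \<inter> pm_ends d J = {}" and "m \<ge> 1"
  shows "\<not> pm_hits d f J c \<sigma> m c'"
proof
  assume hit: "pm_hits d f J c \<sigma> m c'"
  show False
  proof (cases "m = 1")
    case True
    then have "((\<lambda>e. f (c + \<sigma> * e)) \<longlongrightarrow> c') (at_right 0)" using hit by (simp add: pm_hits_def)
    then have "c' = l" using tendsto_unique[OF trivial_limit_at_right_real _ lim] by simp
    then show False using hit H by (auto simp: pm_hits_def)
  next
    case False
    then have m: "m > 1" using \<open>m \<ge> 1\<close> by simp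
    have "eventually (\<lambda>e. \<forall>i<m. (f ^^ i) (c + \<sigma> * e) \<in> pm_dom d J) (at_right 0)"
      using hit by (simp add: pm_hits_def)
    with topological_tendstoD[OF lim H(1,2)] have "eventually (\<lambda>e. False) (at_right (0::real))"
    proof eventually_elim
      case (elim e)
      then show ?case using elim(2)[rule_format, of 1] m H(3) by auto
    qed
    then show False by simp
  qed
qed

text \<open>Points at a small distance \<open>e\<close> from 0 are at
  \<open>4 + 2 ^ i * e\<^sup>2\<close> after \<open>i + 1\<close> steps. For every fixed order these
  images tend to 4 as \<open>e\<close> shrinks, and 4 is no endpoint.\<close>

lemma no_pm_hits_0:
  assumes \<sigma>: "\<sigma> \<in> {1, -1}" and "m \<ge> 1"
  shows "\<not> pm_hits 5 (branch_map 0) branch 0 \<sigma> m c'"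
proof
  assume hit: "pm_hits 5 (branch_map 0) branch 0 \<sigma> m c'"
  obtain m' where m': "m = Suc m'" using \<open>m \<ge> 1\<close> by (cases m) auto
  have step: "(branch_map 0 ^^ Suc i) (\<sigma> * e) = 4 + 2 ^ i * e\<^sup>2"
    if e: "0 < e" "2 ^ m' * e\<^sup>2 < 1" "e < 1" and "i \<le> m'" for i e
    using that(4)
  proof (induction i)
    case 0
    show ?case using \<sigma> e by (auto simp: branch_map_eq)
  next
    case (Suc i)
    have "2 ^ i * e\<^sup>2 \<le> 2 ^ m' * e\<^sup>2"
      using Suc.prems by (intro mult_right_mono power_increasing) auto
    then have "2 ^ i * e\<^sup>2 < 1" using e by linarith
    moreover have "0 \<le> 2 ^ i * e\<^sup>2" by simp
    ultimately have "branch_map 0 (4 + 2 ^ i * e\<^sup>2) = 2 * (4 + 2 ^ i * e\<^sup>2) - 4"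
      by (intro branch_map_eq(2)) linarith+
    then show ?case using Suc by simp
  qed
  have "((\<lambda>e. 2 ^ m' * e\<^sup>2) \<longlongrightarrow> 2 ^ m' * 0\<^sup>2) (at_right (0::real))"
    by (intro tendsto_intros)
  then have small: "eventually (\<lambda>e. 2 ^ m' * e\<^sup>2 < 1) (at_right (0::real))"
    by (rule order_tendstoD(2)) simp
  have range: "eventually (\<lambda>e. 0 < e \<and> e < 1) (at_right (0::real))"
    by (rule eventually_at_right_0I) auto
  have "((\<lambda>e. 4 + 2 ^ m' * e\<^sup>2) \<longlongrightarrow> 4 + 2 ^ m' * 0\<^sup>2) (at_right (0::real))"
    by (intro tendsto_intros)
  then have "((\<lambda>e. (branch_map 0 ^^ m) (0 + \<sigma> * e)) \<longlongrightarrow> 4 + 2 ^ m' * 0\<^sup>2) (at_right 0)"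
  proof (rule Lim_transform_eventually)
    from small range show "eventually (\<lambda>e. 4 + 2 ^ m' * e\<^sup>2 = (branch_map 0 ^^ m) (0 + \<sigma> * e)) (at_right 0)"
      by eventually_elim (use step[of _ m'] in \<open>simp add: m'\<close>)
  qed
  moreover have "((\<lambda>e. (branch_map 0 ^^ m) (0 + \<sigma> * e)) \<longlongrightarrow> c') (at_right 0)"
    using hit by (simp add: pm_hits_def)
  ultimately have "c' = 4" using tendsto_unique[OF trivial_limit_at_right_real] by force
  then show False using hit by (simp add: pm_hits_def pm_ends_branch)
qed

lemma branch_map_tendsto:
  fixes p :: "real \<Rightarrow> real"
  assumes "\<And>e. 0 < e \<Longrightarrow> e < 1/8 \<Longrightarrow> branch_map k (c + \<sigma> * e) = p e" and "isCont p 0" "p 0 = l"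
  shows "((\<lambda>e. branch_map k (c + \<sigma> * e)) \<longlongrightarrow> l) (at_right 0)"
proof (rule Lim_transform_eventually)
  show "(p \<longlongrightarrow> l) (at_right 0)"
    using tendsto_within_subset[OF isContD[OF assms(2)] subset_UNIV] unfolding assms(3) .
  show "eventually (\<lambda>e. p e = branch_map k (c + \<sigma> * e)) (at_right 0)"
    by (rule eventually_at_right_0I) (simp add: assms(1))
qed

text \<open>The side \<open>\<sigma>\<close> must point into a branch. From -1, 1, 5/4 and 17/4 the
  image then tends to a point off the closed domain, and 0 is excluded by
  \<open>no_pm_hits_0\<close>. At 6, 13/2 and 7 the image tends to an endpoint at once, so
  minimality forces \<open>n = 1\<close>.\<close>

lemma crit_rel_branch_map_0:
  assumes rel: "crit_rel 5 (branch_map 0) branch c c' \<sigma> n"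
  shows "c \<ge> 6 \<and> n = 1"
proof -
  let ?H = "{..<-1} \<union> {1<..<5/4} \<union> {17/4<..<6} \<union> {7<..} :: real set"
  have H: "open ?H" "?H \<inter> pm_dom 5 branch = {}" "?H \<inter> pm_ends 5 branch = {}"
    by (intro open_Un open_lessThan open_greaterThan open_greaterThanLessThan)
       (auto simp: pm_dom_branch pm_ends_branch)
  have c: "c \<in> {-1, 0, 1, 5/4, 17/4, 6, 13/2, 7}" and \<sigma>: "\<sigma> = 1 \<or> \<sigma> = -1" and n: "n \<ge> 1"
    and hit: "pm_hits 5 (branch_map 0) branch c \<sigma> n c'"
    and min: "\<And>m c''. 1 \<le> m \<Longrightarrow> m < n \<Longrightarrow> \<not> pm_hits 5 (branch_map 0) branch c \<sigma> m c''"
    using rel by (auto simp: crit_rel_def pm_ends_branch)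
  have out: "\<not> (\<forall>e. 0 < e \<longrightarrow> e < 1/8 \<longrightarrow> c + \<sigma> * e \<notin> pm_dom 5 branch)"
    using no_pm_hits_outside[OF eventually_at_right_0I n] hit by blast
  have esc: "\<not> ((\<lambda>e. branch_map 0 (c + \<sigma> * e)) \<longlongrightarrow> l) (at_right 0)" if "l \<in> ?H" for l
    using no_pm_hits_escape[OF _ H(1) that H(2,3) n] hit by blast
  have one: "n = 1" if "((\<lambda>e. branch_map 0 (c + \<sigma> * e)) \<longlongrightarrow> l) (at_right 0)" "l \<in> pm_ends 5 branch"
    "\<forall>e. 0 < e \<longrightarrow> e < 1/8 \<longrightarrow> c + \<sigma> * e \<in> pm_dom 5 branch" for l
  proof -
    have "pm_hits 5 (branch_map 0) branch c \<sigma> 1 l"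
      using that by (auto simp: pm_hits_def intro!: eventually_at_right_0I)
    then show ?thesis using min[of 1 l] n by force
  qed
  from c consider "c = -1" | "c = 0" | "c = 1" | "c = 5/4" | "c = 17/4" | "c = 6" | "c = 13/2" | "c = 7" by auto
  then show ?thesis
  proof cases
    case 1
    then have s: "\<sigma> = 1" using \<sigma> out by (auto simp: pm_dom_branch)
    have "((\<lambda>e. branch_map 0 (c + \<sigma> * e)) \<longlongrightarrow> 5) (at_right 0)"
      by (rule branch_map_tendsto[where p = "\<lambda>e. 4 + (-1 + e)\<^sup>2"]) (auto simp: 1 s branch_map_eq)
    then show ?thesis using esc[of 5] by simp
  next
    case 2
    then show ?thesis using no_pm_hits_0[of \<sigma> n c'] \<sigma> n hit by auto
  next
    case 3
    then have s: "\<sigma> = -1" using \<sigma> out by (auto simp: pm_dom_branch)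
    have "((\<lambda>e. branch_map 0 (c + \<sigma> * e)) \<longlongrightarrow> 5) (at_right 0)"
      by (rule branch_map_tendsto[where p = "\<lambda>e. 4 + (1 - e)\<^sup>2"]) (auto simp: 3 s branch_map_eq)
    then show ?thesis using esc[of 5] by simp
  next
    case 4
    then have s: "\<sigma> = 1" using \<sigma> out by (auto simp: pm_dom_branch)
    have "((\<lambda>e. branch_map 0 (c + \<sigma> * e)) \<longlongrightarrow> -3/2) (at_right 0)"
      by (rule branch_map_tendsto[where p = "\<lambda>e. -3/2 + 2 * e"]) (auto simp: 4 s branch_map_eq)
    then show ?thesis using esc[of "-3/2"] by simp
  next
    case 5
    then have s: "\<sigma> = -1" using \<sigma> out by (auto simp: pm_dom_branch)
    have "((\<lambda>e. branch_map 0 (c + \<sigma> * e)) \<longlongrightarrow> 9/2) (at_right 0)"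
      by (rule branch_map_tendsto[where p = "\<lambda>e. 9/2 - 2 * e"]) (auto simp: 5 s branch_map_eq)
    then show ?thesis using esc[of "9/2"] by simp
  next
    case 6
    then have s: "\<sigma> = 1" using \<sigma> out by (auto simp: pm_dom_branch)
    have "((\<lambda>e. branch_map 0 (c + \<sigma> * e)) \<longlongrightarrow> 6) (at_right 0)"
      by (rule branch_map_tendsto[where p = "\<lambda>e. 6 + 2 * e"]) (auto simp: 6 s branch_map_eq)
    then show ?thesis using one[of 6] by (auto simp: 6 s pm_dom_branch pm_ends_branch)
  next
    case 7
    have "((\<lambda>e. branch_map 0 (c + \<sigma> * e)) \<longlongrightarrow> (if \<sigma> = 1 then 6 else 7)) (at_right 0)"
      by (rule branch_map_tendsto[where p = "\<lambda>e. (if \<sigma> = 1 then 6 + 2 * e else 7 - 2 * e)"])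
         (use \<sigma> in \<open>auto simp: 7 branch_map_eq\<close>)
    then show ?thesis using one[of "if \<sigma> = 1 then 6 else 7"] \<sigma>
      by (auto simp: 7 pm_dom_branch pm_ends_branch)
  next
    case 8
    then have s: "\<sigma> = -1" using \<sigma> out by (auto simp: pm_dom_branch)
    have "((\<lambda>e. branch_map 0 (c + \<sigma> * e)) \<longlongrightarrow> 7) (at_right 0)"
      by (rule branch_map_tendsto[where p = "\<lambda>e. 7 - 2 * e"]) (auto simp: 8 s branch_map_eq)
    then show ?thesis using one[of 7] by (auto simp: 8 s pm_dom_branch pm_ends_branch)
  qed
qed

text \<open>By \<open>crit_rel_branch_map_0\<close> only relations of order one at endpoints from 6
  on have to persist. There the maps do not depend on \<open>k\<close>, and minimality at order one
  is vacuous.\<close>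

lemma decreasing_crit_rels_branch: "decreasing_crit_rels 5 branch_map (\<lambda>_. branch) (\<lambda>_. id)"
  unfolding decreasing_crit_rels_def
proof (intro allI impI)
  fix k c c' \<sigma> n
  assume rel: "crit_rel 5 (branch_map 0) branch c c' \<sigma> n"
  then have c: "c \<ge> 6" and n: "n = 1" using crit_rel_branch_map_0 by auto
  have hit: "pm_hits 5 (branch_map 0) branch c \<sigma> 1 c'" and \<sigma>: "\<sigma> \<in> {1, -1}" and "c \<in> pm_ends 5 branch"
    using rel n by (auto simp: crit_rel_def)
  have "((\<lambda>e. branch_map k (c + \<sigma> * e)) \<longlongrightarrow> c') (at_right 0)"
  proof (rule Lim_transform_eventually)
    show "((\<lambda>e. branch_map 0 (c + \<sigma> * e)) \<longlongrightarrow> c') (at_right 0)" using hit by (simp add: pm_hits_def)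
    show "eventually (\<lambda>e. branch_map 0 (c + \<sigma> * e) = branch_map k (c + \<sigma> * e)) (at_right 0)"
      by (rule eventually_at_right_0I) (use c \<sigma> in \<open>auto simp: branch_map_def\<close>)
  qed
  then have "pm_hits 5 (branch_map k) branch c \<sigma> 1 c'" using hit by (simp add: pm_hits_def)
  then show "crit_rel 5 (branch_map k) branch (id c) (id c') \<sigma> n"
    using \<sigma> \<open>c \<in> pm_ends 5 branch\<close> by (auto simp: crit_rel_def n)
qed

section \<open>Invariant measures and entropy of the maps\<close>

lemma branch_map_measurable [measurable]: "branch_map k \<in> borel_measurable borel"
  unfolding branch_map_def[abs_def] by measurable

lemma dom_sets [measurable]: "pm_dom 5 branch \<in> sets borel"
  unfolding pm_dom_branch by auto

lemma borel_system_if_invariant: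
  assumes "invariant_prob 5 (branch_map k) branch \<nu>"
  shows "borel_system \<nu> (branch_map k) (pm_dom 5 branch)"
proof -
  interpret prob_space \<nu> using assms by (simp add: invariant_prob_def)
  have sets: "sets \<nu> = sets borel" and D: "prob (pm_dom 5 branch) = 1"
    and inv: "\<And>A. A \<in> sets borel \<Longrightarrow> prob {x \<in> pm_dom 5 branch. branch_map k x \<in> A} = prob A"
    using assms by (auto simp: invariant_prob_def)
  note sets[measurable_cong]
  show ?thesis
  proof
    fix A :: "real set" assume A[measurable]: "A \<in> sets borel"
    have "prob (branch_map k -` A) = prob {x \<in> pm_dom 5 branch. branch_map k x \<in> A}"
    proof (rule finite_measure_eq_AE)
      have "AE x in \<nu>. x \<in> pm_dom 5 branch"
        using D by (intro prob_eq_1[THEN iffD1]) (auto simp: sets)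
      then show "AE x in \<nu>. (x \<in> branch_map k -` A) = (x \<in> {x \<in> pm_dom 5 branch. branch_map k x \<in> A})"
        by eventually_elim simp
      show "branch_map k -` A \<in> events" using measurable_sets[OF branch_map_measurable A] sets by simp
      show "{x \<in> pm_dom 5 branch. branch_map k x \<in> A} \<in> events" unfolding sets by measurable
    qed
    then show "prob (branch_map k -` A) = prob A" using inv[OF A] by simp
  qed (use sets D in auto)
qed

section \<open>Expansion on the doubling region\<close>

lemma branch_map_unit_interval: "x \<in> {6<..<7} \<Longrightarrow> branch_map k x \<in> {6..<7}"
  by (auto simp: branch_map_def)

lemma expansion_on_common_cylinder:
  assumes "\<forall>i<n. (branch_map k ^^ i) x \<in> {6<..<7} \<and> (branch_map k ^^ i) y \<in> {6<..<7} \<and>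
      ((branch_map k ^^ i) x < 13/2 \<longleftrightarrow> (branch_map k ^^ i) y < 13/2)"
  shows "(branch_map k ^^ n) x - (branch_map k ^^ n) y = 2 ^ n * (x - y)"
  using assms
proof (induction n)
  case (Suc n)
  let ?u = "(branch_map k ^^ n) x" and ?v = "(branch_map k ^^ n) y"
  have "?u - ?v = 2 ^ n * (x - y)" using Suc by simp
  moreover have "branch_map k ?u - branch_map k ?v = 2 * (?u - ?v)"
    using Suc.prems[rule_format, of n] by (auto simp: branch_map_def)
  ultimately show ?case by simp
qed simp

text \<open>The difference of the two points is doubled \<open>n\<close> times, while the images
  still lie in a half-open interval of length one; with \<open>n = 0\<close> nothing would confine
  them.\<close>

lemma common_cylinder_dist:
  assumes n: "n \<ge> 1" and "\<forall>i<n. (branch_map k ^^ i) x \<in> {6<..<7} \<and> (branch_map k ^^ i) y \<in> {6<..<7} \<and>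
      ((branch_map k ^^ i) x < 13/2 \<longleftrightarrow> (branch_map k ^^ i) y < 13/2)"
  shows "\<bar>x - y\<bar> < 1 / 2 ^ n"
proof -
  obtain m where m: "n = Suc m" using n by (cases n) auto
  have "(branch_map k ^^ n) x \<in> {6..<7}" "(branch_map k ^^ n) y \<in> {6..<7}"
    using branch_map_unit_interval assms(2)[rule_format, of m] by (simp_all add: m)
  then have "\<bar>2 ^ n * (x - y)\<bar> < 1"
    unfolding expansion_on_common_cylinder[OF assms(2), symmetric] by auto
  then show ?thesis by (simp add: abs_mult pos_less_divide_eq mult.commute)
qed

section \<open>Points that never leave the domain of the limit map\<close>

definition survivors :: "real set" where
  "survivors = {x. \<forall>n. (branch_map 0 ^^ n) x \<in> pm_dom 5 branch}"

lemma survivors_dom: "x \<in> survivors \<Longrightarrow> x \<in> pm_dom 5 branch"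
  unfolding survivors_def by (auto dest: spec[of _ 0])

lemma survivors_funpow: "x \<in> survivors \<Longrightarrow> (branch_map 0 ^^ i) x \<in> survivors"
  unfolding survivors_def by (auto simp: funpow_add[symmetric, unfolded comp_def, THEN fun_cong])

lemma survivors_step: "x \<in> survivors \<Longrightarrow> branch_map 0 x \<in> survivors"
  using survivors_funpow[of x 1] by simp

text \<open>The distance to the fixed point 4 doubles in every step, but the third branch reaches
  only 1/4 beyond 4, and its images from 17/4 on fall into a gap.\<close>

lemma no_survivor_right: "4 < x \<Longrightarrow> x < 5 \<Longrightarrow> x \<notin> survivors"
proof
  assume x: "4 < x" "x < 5" "x \<in> survivors"
  have inv: "(branch_map 0 ^^ n) x = 4 + 2 ^ n * (x - 4) \<and> 2 ^ n * (x - 4) < 1/4" for n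
  proof (induction n)
    case 0
    then show ?case using survivors_dom[OF x(3)] x by (auto simp: pm_dom_branch)
  next
    case (Suc n)
    let ?y = "4 + 2 ^ n * (x - 4)"
    have p: "0 < 2 ^ n * (x - 4)" using x by simp
    have y: "?y < 17/4" "4 < ?y" using Suc p by linarith+
    have eq: "(branch_map 0 ^^ Suc n) x = 4 + 2 * (2 ^ n * (x - 4))"
      using Suc y by (simp add: branch_map_eq(2))
    have "(branch_map 0 ^^ Suc n) x \<in> pm_dom 5 branch" using x(3) unfolding survivors_def by blast
    then have "2 * (2 ^ n * (x - 4)) < 1/4"
      unfolding eq using y by (auto simp: pm_dom_branch)
    then show ?case using eq by simp
  qed
  obtain n where "1 / (x - 4) < 2 ^ n" using real_arch_pow[of 2] by force
  then have "1 < 2 ^ n * (x - 4)" using x by (simp add: field_simps)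
  then show False using inv[of n] by simp
qed

lemma no_survivor_centre: "-1 < x \<Longrightarrow> x < 1 \<Longrightarrow> x \<notin> survivors"
proof
  assume x: "-1 < x" "x < 1" "x \<in> survivors"
  have "x \<noteq> 0" using survivors_dom[OF x(3)] by (auto simp: pm_dom_branch)
  then have "0 < x\<^sup>2" "x\<^sup>2 < 1" using x by (auto simp: abs_square_less_1)
  then have "branch_map 0 x \<notin> survivors"
    using x by (intro no_survivor_right) (simp_all add: branch_map_eq)
  then show False using survivors_step[OF x(3)] by simp
qed

text \<open>The distance to 4 doubles until the orbit leaves the third branch to the left, at
  distance at least 11/4. It is then above -3/2 and at most 5/4, hence outside the domain or in a
  central branch, and neither is possible for a survivor.\<close>

lemma no_survivor_left: "5/4 < x \<Longrightarrow> x < 4 \<Longrightarrow> x \<notin> survivors"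
proof
  assume x: "5/4 < x" "x < 4" "x \<in> survivors"
  have inv: "(branch_map 0 ^^ n) x = 4 - 2 ^ n * (4 - x) \<and> 2 ^ n * (4 - x) < 11/4" for n
  proof (induction n)
    case 0
    then show ?case using x by simp
  next
    case (Suc n)
    let ?y = "4 - 2 ^ n * (4 - x)"
    have p: "0 < 2 ^ n * (4 - x)" using x by simp
    have y: "5/4 < ?y" "?y < 4" using Suc p by linarith+
    have eq: "(branch_map 0 ^^ Suc n) x = 4 - 2 * (2 ^ n * (4 - x))"
      using Suc y by (simp add: branch_map_eq(2))
    have S: "(branch_map 0 ^^ Suc n) x \<in> survivors" by (rule survivors_funpow[OF x(3)])
    have "2 * (2 ^ n * (4 - x)) < 11/4"
      using no_survivor_centre[of "(branch_map 0 ^^ Suc n) x"] survivors_dom[OF S] S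
      unfolding eq using y p by (auto simp: pm_dom_branch)
    then show ?case using eq by simp
  qed
  obtain n where "3 / (4 - x) < 2 ^ n" using real_arch_pow[of 2] by force
  then have "3 < 2 ^ n * (4 - x)" using x by (simp add: field_simps)
  then show False using inv[of n] by simp
qed

lemma survivors_cases: "x \<in> survivors \<Longrightarrow> x = 4 \<or> x \<in> {6<..<7}"
  using survivors_dom[of x] no_survivor_right[of x] no_survivor_centre[of x] no_survivor_left[of x]
  by (cases x "4::real" rule: linorder_cases) (auto simp: pm_dom_branch)

lemma funpow_4: "(branch_map 0 ^^ i) 4 = 4"
  by (induction i) (simp_all add: branch_map_eq(2))

lemma survivors_unit_interval:
  assumes "x \<in> survivors" "x \<in> {6<..<7}"
  shows "(branch_map 0 ^^ i) x \<in> {6<..<7}"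
proof (induction i)
  case (Suc i)
  then have "(branch_map 0 ^^ Suc i) x \<in> {6..<7}" using branch_map_unit_interval by simp
  then show ?case using survivors_cases[OF survivors_funpow[OF assms(1), of "Suc i"]] by auto
qed (use assms in simp)

text \<open>On survivors the symbol 0 means the fixed point 4, and 1 and 2 are the binary digits of
  the doubling map. Hence there are at most \<open>2 ^ n + 1\<close> itineraries of length
  \<open>n\<close>.\<close>

definition symbol :: "real \<Rightarrow> nat" where
  "symbol x = (if x < 6 then 0 else if x < 13/2 then 1 else 2)"

lemma itinerary_survivors_subset:
  "itinerary (branch_map 0) symbol n ` survivors \<subseteq> words {1, 2} n \<union> {replicate n 0}"
proof
  fix v assume "v \<in> itinerary (branch_map 0) symbol n ` survivors"
  then obtain x where x: "x \<in> survivors" "v = itinerary (branch_map 0) symbol n x" by auto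
  show "v \<in> words {1, 2} n \<union> {replicate n 0}"
  proof (cases "x = 4")
    case True
    then have "v = replicate n 0"
      unfolding x(2) by (intro nth_equalityI) (auto simp: itinerary_def funpow_4 symbol_def)
    then show ?thesis by simp
  next
    case False
    then have "(branch_map 0 ^^ i) x \<in> {6<..<7}" for i
      using survivors_unit_interval[OF x(1)] survivors_cases[OF x(1)] by blast
    then have "symbol ((branch_map 0 ^^ i) x) \<in> {1, 2}" for i
      by (auto simp: symbol_def not_less less_imp_le)
    then show ?thesis unfolding x(2) by (auto simp: words_def itinerary_def)
  qed
qed

lemma card_words: "finite P \<Longrightarrow> card (words P n) = card P ^ n"
  unfolding words_def by (rule card_lists_length_eq)

lemma itinerary_survivors_card:
  "finite (itinerary (branch_map 0) symbol n ` survivors)"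
  "real (card (itinerary (branch_map 0) symbol n ` survivors)) \<le> 2 * 2 ^ n"
proof -
  have fin: "finite (words {1, 2::nat} n \<union> {replicate n 0})" by (simp add: finite_words)
  show "finite (itinerary (branch_map 0) symbol n ` survivors)"
    by (rule finite_subset[OF itinerary_survivors_subset fin])
  have "card (itinerary (branch_map 0) symbol n ` survivors) \<le> card (words {1, 2::nat} n \<union> {replicate n 0})"
    by (rule card_mono[OF fin itinerary_survivors_subset])
  also have "\<dots> \<le> card (words {1, 2::nat} n) + card {replicate n (0::nat)}" by (rule card_Un_le)
  also have "\<dots> = 2 ^ n + 1" by (simp add: card_words numeral_2_eq_2)
  also have "\<dots> \<le> 2 * 2 ^ n" by simp
  finally have "card (itinerary (branch_map 0) symbol n ` survivors) \<le> 2 * 2 ^ n" .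
  then have "real (card (itinerary (branch_map 0) symbol n ` survivors)) \<le> real (2 * 2 ^ n)"
    by (rule of_nat_mono)
  then show "real (card (itinerary (branch_map 0) symbol n ` survivors)) \<le> 2 * 2 ^ n" by simp
qed

lemma itinerary_separates:
  assumes "r > 0"
  shows "\<exists>m. \<forall>x\<in>survivors. \<forall>y\<in>survivors.
    itinerary (branch_map 0) symbol m x = itinerary (branch_map 0) symbol m y \<longrightarrow> dist x y < r"
proof -
  obtain m where m: "(1/2) ^ m < r" using real_arch_pow_inv[of r "1/2"] assms by auto
  show ?thesis
  \<comment> \<open>A length of at least one is needed both to tell 4 from the doubling region and
    to apply \<open>common_cylinder_dist\<close>.\<close>
  proof (intro exI[of _ "Suc m"] ballI impI)
    fix x y assume x: "x \<in> survivors" and y: "y \<in> survivors"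
      and eq: "itinerary (branch_map 0) symbol (Suc m) x = itinerary (branch_map 0) symbol (Suc m) y"
    have sym: "symbol ((branch_map 0 ^^ i) x) = symbol ((branch_map 0 ^^ i) y)" if "i < Suc m" for i
      using arg_cong[OF eq, of "\<lambda>v. v ! i"] that by (simp add: itinerary_def del: upt_Suc)
    have iff: "x \<in> {6<..<7} \<longleftrightarrow> y \<in> {6<..<7}"
      using sym[of 0] survivors_cases[OF x] survivors_cases[OF y]
      by (auto simp: symbol_def split: if_splits)
    show "dist x y < r"
    proof (cases "x \<in> {6<..<7}")
      case True
      then have I: "(branch_map 0 ^^ i) x \<in> {6<..<7}" "(branch_map 0 ^^ i) y \<in> {6<..<7}" for i
        using survivors_unit_interval x y iff by auto
      have "\<bar>x - y\<bar> < 1 / 2 ^ Suc m"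
      proof (rule common_cylinder_dist[where k = 0], simp, intro allI impI conjI I)
        fix i assume "i < Suc m"
        then show "((branch_map 0 ^^ i) x < 13/2) = ((branch_map 0 ^^ i) y < 13/2)"
          using sym[of i] I[of i] by (auto simp: symbol_def split: if_splits)
      qed
      also have "1 / 2 ^ Suc m \<le> (1/2::real) ^ m" by (simp add: power_one_over field_simps)
      finally show ?thesis using m by (simp add: dist_real_def)
    next
      case False
      then have "x = 4" "y = 4" using survivors_cases[OF x] survivors_cases[OF y] iff by blast+
      then show ?thesis using assms by simp
    qed
  qed
qed

section \<open>Maximal entropy and Lyapunov exponents of the limit map\<close>

lemma ks_entropy_le_ln2:
  assumes "invariant_prob 5 (branch_map 0) branch \<nu>"
  shows "ks_entropy 5 (branch_map 0) branch \<nu> \<le> ereal (ln 2)"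
  unfolding ks_entropy_def
proof (rule SUP_least)
  interpret borel_system \<nu> "branch_map 0" "pm_dom 5 branch" by (rule borel_system_if_invariant[OF assms])
  fix P assume "P \<in> {P. meas_partition (pm_dom 5 branch) P}"
  then interpret borel_partition \<nu> "branch_map 0" "pm_dom 5 branch" P by unfold_locales simp
  have "entropy_wrt \<nu> (branch_map 0) P \<le> ln 2"
  proof (rule entropy_wrt_le[where S = survivors and s = symbol and C = 2])
    show "AE x in \<nu>. x \<in> survivors" using AE_funpow_D by (simp add: survivors_def)
  qed (use survivors_step itinerary_survivors_card itinerary_separates in auto)
  then show "ereal (entropy_wrt \<nu> (branch_map 0) P) \<le> ereal (ln 2)" by simp
qed

lemma pm_deriv_branch:
  assumes "x \<in> pm_dom 5 branch"
  shows "pm_deriv 5 (branch_map k) branch x = branch_slope x"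
  unfolding pm_deriv_def
proof (rule the_equality)
  obtain j where j: "j < 5" "x \<in> branch j" using assms by (auto simp: pm_dom_def)
  then show "\<exists>j<5. x \<in> branch j \<and> (branch_map k has_real_derivative branch_slope x) (at x within branch j)"
    using has_field_derivative_at_within[OF branch_map_has_derivative[OF assms]] by blast
  fix D assume "\<exists>j<5. x \<in> branch j \<and> (branch_map k has_real_derivative D) (at x within branch j)"
  then have "(branch_map k has_real_derivative D) (at x)"
    using open_branch at_within_open by metis
  then show "D = branch_slope x" using DERIV_unique[OF _ branch_map_has_derivative[OF assms]] by blast
qed

lemma lyapunov_branch_map_0:
  assumes "invariant_prob 5 (branch_map 0) branch \<nu>"
  shows "lyapunov 5 (branch_map 0) branch \<nu> = ereal (ln 2)"
proof -
  interpret borel_system \<nu> "branch_map 0" "pm_dom 5 branch" by (rule borel_system_if_invariant[OF assms])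
  have AE: "AE x in \<nu>. pm_deriv 5 (branch_map 0) branch x = 2"
    using AE_funpow_D
  proof eventually_elim
    case (elim x)
    then have "x \<in> survivors" by (simp add: survivors_def)
    then show ?case
      using pm_deriv_branch[OF survivors_dom] survivors_cases[of x] by (auto simp: branch_slope_def)
  qed
  have "(\<integral>\<^sup>+ x. ennreal (max 0 (ln \<bar>pm_deriv 5 (branch_map 0) branch x\<bar>)) \<partial>\<nu>) = (\<integral>\<^sup>+ x. ennreal (ln 2) \<partial>\<nu>)"
    by (rule nn_integral_cong_AE) (use AE in eventually_elim, simp)
  moreover have "(\<integral>\<^sup>+ x. ennreal (max 0 (- ln \<bar>pm_deriv 5 (branch_map 0) branch x\<bar>)) \<partial>\<nu>) = (\<integral>\<^sup>+ x. 0 \<partial>\<nu>)"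
    by (rule nn_integral_cong_AE) (use AE in eventually_elim, simp)
  ultimately show ?thesis
    using emeasure_space_1 unfolding lyapunov_def by (simp add: zero_ennreal.rep_eq)
qed

lemma equilibrium_stateI:
  assumes "invariant_prob 5 (branch_map 0) branch \<mu>"
    and "ereal (ln 2) \<le> ks_entropy 5 (branch_map 0) branch \<mu>"
  shows "equilibrium_state 5 (branch_map 0) branch \<mu>"
  unfolding equilibrium_state_def
proof (intro conjI allI impI)
  fix \<nu> assume \<nu>: "invariant_prob 5 (branch_map 0) branch \<nu>"
  have "ks_entropy 5 (branch_map 0) branch \<nu> \<le> ks_entropy 5 (branch_map 0) branch \<mu>"
    using ks_entropy_le_ln2[OF \<nu>] assms(2) by (rule order_trans)
  then show "ks_entropy 5 (branch_map 0) branch \<nu> - lyapunov 5 (branch_map 0) branch \<nu> \<le>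
      ks_entropy 5 (branch_map 0) branch \<mu> - lyapunov 5 (branch_map 0) branch \<mu>"
    unfolding lyapunov_branch_map_0[OF \<nu>] lyapunov_branch_map_0[OF assms(1)]
    by (intro ereal_minus_mono) auto
qed (rule assms(1))

text \<open>Partition into the two halves of \<open>(6, 7)\<close> and the rest. A cylinder that
  meets \<open>(6, 7)\<close> lies in it and has radius at most \<open>1 / 2 ^ n\<close> about each
  of its points, so by \<open>dens\<close> its measure is at most \<open>2 / 2 ^ n\<close>. These
  cylinders have total mass at least \<open>t\<close>, each with minus log measure at least
  \<open>(n - 1) * ln 2\<close>; the others contribute nonnegatively.\<close>

lemma ks_entropy_ge:
  assumes inv: "invariant_prob 5 (branch_map k) branch \<nu>"
    and mass: "measure \<nu> {6<..<7} \<ge> t"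
    and dens: "\<And>x r. r \<ge> 0 \<Longrightarrow> measure \<nu> ({6<..<7} \<inter> cball x r) \<le> 2 * r"
  shows "ereal (t * ln 2) \<le> ks_entropy 5 (branch_map k) branch \<nu>"
proof -
  define B where "B = {-1<..<0} \<union> {0<..<1} \<union> {5/4<..<17/4 :: real}"
  define P where "P = {{6<..<13/2}, {13/2<..<7}, B}"
  interpret borel_system \<nu> "branch_map k" "pm_dom 5 branch" by (rule borel_system_if_invariant[OF inv])
  have part: "meas_partition (pm_dom 5 branch) P"
    unfolding meas_partition_def P_def pm_dom_branch
    by (auto simp: B_def pairwise_insert disjnt_def)
  interpret borel_partition \<nu> "branch_map k" "pm_dom 5 branch" P by unfold_locales (rule part)
  let ?f = "branch_map k"
  have same: "\<forall>i<n. (?f ^^ i) x \<in> {6<..<7} \<and> (?f ^^ i) y \<in> {6<..<7} \<and> ((?f ^^ i) x < 13/2 \<longleftrightarrow> (?f ^^ i) y < 13/2)"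
    if w: "w \<in> words P n" and x: "x \<in> word_cyl ?f w" "x \<in> {6<..<7}" and y: "y \<in> word_cyl ?f w" for w n x y
  proof (intro allI impI)
    have letter: "w ! i \<in> P" "(?f ^^ i) x \<in> w ! i" "(?f ^^ i) y \<in> w ! i" if "i < n" for i
      using w x y that by (auto simp: words_def word_cyl_def)
    have fromx: "(?f ^^ i) x \<in> {6<..<7} \<and> (?f ^^ i) y \<in> {6<..<7} \<and> ((?f ^^ i) x < 13/2 \<longleftrightarrow> (?f ^^ i) y < 13/2)"
      if "i < n" "(?f ^^ i) x \<in> {6..<7}" for i
      using letter[OF that(1)] that(2) by (auto simp: P_def B_def)
    fix i assume "i < n"
    then show "(?f ^^ i) x \<in> {6<..<7} \<and> (?f ^^ i) y \<in> {6<..<7} \<and> ((?f ^^ i) x < 13/2 \<longleftrightarrow> (?f ^^ i) y < 13/2)"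
    proof (induction i)
      case 0
      then show ?case using fromx[of 0] x(2) by auto
    next
      case (Suc i)
      then have "(?f ^^ Suc i) x \<in> {6..<7}" using branch_map_unit_interval by simp
      then show ?case using fromx[of "Suc i"] Suc.prems by blast
    qed
  qed
  have small: "prob (word_cyl ?f w) \<le> 2 / 2 ^ n"
    if w: "w \<in> words P n" and x: "x \<in> word_cyl ?f w" "x \<in> {6<..<7}" and n: "n \<ge> 1" for w n x
  proof -
    have "word_cyl ?f w \<subseteq> {6<..<7} \<inter> cball x (1 / 2 ^ n)"
    proof
      fix y assume y: "y \<in> word_cyl ?f w"
      show "y \<in> {6<..<7} \<inter> cball x (1 / 2 ^ n)"
        using same[OF w x y] common_cylinder_dist[OF n same[OF w x y]] n
        by (auto simp: dist_real_def dest: spec[of _ 0])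
    qed
    then have "prob (word_cyl ?f w) \<le> prob ({6<..<7} \<inter> cball x (1 / 2 ^ n))"
      by (intro finite_measure_mono) (auto simp: sets_M)
    also have "\<dots> \<le> 2 * (1 / 2 ^ n)" by (rule dens) simp
    finally show ?thesis by simp
  qed
  have bound: "(real n - 1) * (t * ln 2) \<le> part_entropy \<nu> (cylinders ?f P n)" if n: "n \<ge> 1" for n
  proof -
    let ?p = "\<lambda>w. prob (word_cyl ?f w)"
    have "(real n - 1) * (t * ln 2) = t * ((real n - 1) * ln 2)" by simp
    also have "\<dots> \<le> prob {6<..<7} * ((real n - 1) * ln 2)"
      using mass n by (intro mult_right_mono) auto
    also have "\<dots> = (\<Sum>w\<in>words P n. prob ({6<..<7} \<inter> word_cyl ?f w) * ((real n - 1) * ln 2))"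
      by (simp add: sum_distrib_right[symmetric] sum_prob_word_cyl_Int)
    also have "\<dots> \<le> (\<Sum>w\<in>words P n. - ?p w * ln (?p w))"
    proof (rule sum_mono)
      fix w assume w: "w \<in> words P n"
      have nonneg: "0 \<le> - ?p w * ln (?p w)" if "?p w > 0"
        using that by (simp add: mult_nonneg_nonpos)
      show "prob ({6<..<7} \<inter> word_cyl ?f w) * ((real n - 1) * ln 2) \<le> - ?p w * ln (?p w)"
      proof (cases "prob ({6<..<7} \<inter> word_cyl ?f w) = 0")
        case True
        then show ?thesis using nonneg by (cases "?p w = 0") (auto simp: zero_less_measure_iff)
      next
        case False
        have le: "prob ({6<..<7} \<inter> word_cyl ?f w) \<le> ?p w"
          using word_cyl_sets[OF w] by (intro finite_measure_mono) (auto simp: sets_M)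
        from False have p: "?p w > 0" using le measure_nonneg[of \<nu> "{6<..<7} \<inter> word_cyl ?f w"] by linarith
        from False have "{6<..<7} \<inter> word_cyl ?f w \<noteq> {}" by auto
        then obtain x where "x \<in> word_cyl ?f w" "x \<in> {6<..<7}" by blast
        from small[OF w this n] have "ln (?p w) \<le> ln (2 / 2 ^ n)" using p by (intro ln_mono) auto
        also have "\<dots> = - ((real n - 1) * ln 2)" by (simp add: ln_div ln_realpow algebra_simps)
        finally have "(real n - 1) * ln 2 \<le> - ln (?p w)" by simp
        then have "prob ({6<..<7} \<inter> word_cyl ?f w) * ((real n - 1) * ln 2) \<le> ?p w * - ln (?p w)"
          using le n by (intro mult_mono) auto
        then show ?thesis by simp
      qed
    qed
    finally show ?thesis unfolding part_entropy_eq_words .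
  qed
  have "(\<lambda>n. (1 - 1 / real n) * (t * ln 2)) \<longlonglongrightarrow> (1 - 0) * (t * ln 2)"
    by (intro tendsto_intros lim_1_over_n)
  then have "(1 - 0) * (t * ln 2) \<le> entropy_wrt \<nu> ?f P"
  proof (rule LIMSEQ_le[OF _ entropy_wrt_LIMSEQ], intro exI[of _ 1] allI impI)
    fix n :: nat assume n: "n \<ge> 1"
    have "(1 - 1 / real n) * (t * ln 2) = (real n - 1) * (t * ln 2) / real n"
      using n by (simp add: field_simps)
    also have "\<dots> \<le> part_entropy \<nu> (cylinders ?f P n) / real n"
      by (intro divide_right_mono bound[OF n]) simp
    finally show "(1 - 1 / real n) * (t * ln 2) \<le> part_entropy \<nu> (cylinders ?f P n) / real n" .
  qed
  then have "ereal (t * ln 2) \<le> ereal (entropy_wrt \<nu> ?f P)" by simp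
  also have "\<dots> \<le> ks_entropy 5 ?f branch \<nu>"
    unfolding ks_entropy_def using part by (intro SUP_upper) simp
  finally show ?thesis .
qed

section \<open>Averages of laws of a uniform variable\<close>

text \<open>The half-open interval makes \<open>(0, 2]\<close> the disjoint union of
  \<open>(0, 1]\<close> and \<open>(1, 2]\<close>, so that doubling needs no exceptional
  points.\<close>

definition unif :: "real measure" where
  "unif = uniform_measure lborel {0<..1}"

lemma sets_unif [measurable_cong, simp]: "sets unif = sets borel"
  by (simp add: unif_def)

lemma space_unif [simp]: "space unif = UNIV"
  by (simp add: unif_def)

lemma prob_space_unif: "prob_space unif"
  unfolding unif_def by (intro prob_space_uniform_measure) auto

interpretation unif: prob_space unif by (rule prob_space_unif)

lemma emeasure_unif: "A \<in> sets borel \<Longrightarrow> emeasure unif A = emeasure lborel ({0<..1} \<inter> A)"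
  unfolding unif_def by (simp add: divide_ennreal_def)

text \<open>\<open>2 * u\<close> runs over two periods of \<open>G\<close> at half the density, so
  the law of \<open>G\<close> does not change. This turns both semiconjugacies into invariance of
  measures.\<close>

lemma unif_doubling:
  fixes G :: "real \<Rightarrow> real"
  assumes G [measurable]: "G \<in> borel_measurable borel" and per: "\<And>v. G (v + 1) = G v"
    and A [measurable]: "A \<in> sets borel"
  shows "measure unif {u. G (2 * u) \<in> A} = measure unif {u. G u \<in> A}"
proof -
  define Q where "Q = {u. G u \<in> A}"
  have Q [measurable]: "Q \<in> sets borel" unfolding Q_def by measurable
  have Q2 [measurable]: "{u. 2 * u \<in> Q} \<in> sets borel" by measurable
  let ?c = "emeasure lborel ({0<..1} \<inter> Q)"
  have shift: "emeasure lborel ({1<..2} \<inter> Q) = ?c"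
  proof -
    have "emeasure lborel ({1<..2} \<inter> Q) = (\<integral>\<^sup>+ v. indicator ({1<..2} \<inter> Q) v \<partial>lborel)" by simp
    also have "\<dots> = ennreal \<bar>1\<bar> * (\<integral>\<^sup>+ v. indicator ({1<..2} \<inter> Q) (1 + 1 * v) \<partial>lborel)"
      by (rule nn_integral_real_affine) auto
    also have "(\<integral>\<^sup>+ v. indicator ({1<..2} \<inter> Q) (1 + 1 * v) \<partial>lborel) = (\<integral>\<^sup>+ v. indicator ({0<..1} \<inter> Q) v \<partial>lborel)"
      using per by (intro nn_integral_cong) (auto simp: indicator_def Q_def add.commute)
    finally show ?thesis by simp
  qed
  have "2 * emeasure lborel ({0<..1} \<inter> {u. 2 * u \<in> Q}) =
      ennreal \<bar>2\<bar> * (\<integral>\<^sup>+ u. indicator ({0<..2} \<inter> Q) (0 + 2 * u) \<partial>lborel)"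
  proof -
    have "(\<integral>\<^sup>+ u. indicator ({0<..2} \<inter> Q) (0 + 2 * u) \<partial>lborel) =
        (\<integral>\<^sup>+ u. indicator ({0<..1} \<inter> {u. 2 * u \<in> Q}) u \<partial>lborel)"
      by (intro nn_integral_cong) (auto simp: indicator_def)
    then show ?thesis by simp
  qed
  also have "\<dots> = (\<integral>\<^sup>+ v. indicator ({0<..2} \<inter> Q) v \<partial>lborel)"
    by (rule nn_integral_real_affine[symmetric]) auto
  also have "\<dots> = emeasure lborel (({0<..1} \<inter> Q) \<union> ({1<..2} \<inter> Q))"
    by (subst nn_integral_indicator) (auto intro!: arg_cong[where f = "emeasure lborel"])
  also have "\<dots> = ?c + emeasure lborel ({1<..2} \<inter> Q)"
    by (intro plus_emeasure[symmetric]) auto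
  also have "\<dots> = 2 * ?c" by (simp add: shift mult_2)
  finally have "emeasure unif {u. 2 * u \<in> Q} = emeasure unif Q"
    by (simp add: emeasure_unif ennreal_mult_cancel_left)
  then show ?thesis by (simp add: measure_def Q_def)
qed

text \<open>This gives absolute continuity of the law of \<open>f u\<close>: where the derivative is
  not zero, preimages of negligible sets are negligible, and finitely many further points do no
  harm.\<close>

lemma unif_null_vimage:
  fixes f :: "real \<Rightarrow> real"
  assumes [measurable]: "f \<in> borel_measurable borel" and N: "N \<in> null_sets lborel"
    and fin: "finite ({0<..1} - S)"
    and deriv: "\<And>u. u \<in> S \<Longrightarrow> (f has_real_derivative f' u) (at u)" and nz: "\<And>u. u \<in> S \<Longrightarrow> f' u \<noteq> 0"
  shows "measure unif {u. f u \<in> N} = 0"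
proof -
  have [measurable]: "N \<in> sets borel" using N by auto
  have "negligible N" using N by (simp add: negligible_iff_null_sets null_sets_completionI)
  then have "negligible {u \<in> S. f u \<in> N}"
  proof (rule negligible_differentiable_vimage)
    fix u assume u: "u \<in> S"
    show "inj ((*) (f' u))" using nz[OF u] by (auto simp: inj_on_def)
    show "(f has_derivative (*) (f' u)) (at u within S)"
      using deriv[OF u] by (auto simp: has_field_derivative_def intro: has_derivative_at_withinI)
  qed
  moreover have "negligible ({0<..1} - S)" using fin by (rule negligible_finite)
  ultimately have "negligible ({u \<in> S. f u \<in> N} \<union> ({0<..1} - S))" by (rule negligible_Un)
  then have "negligible ({0<..1} \<inter> {u. f u \<in> N})" by (rule negligible_subset) auto
  then have "{0<..1} \<inter> {u. f u \<in> N} \<in> null_sets lborel"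
    by (simp add: negligible_iff_null_sets null_sets_completion_iff)
  then have "emeasure unif {u. f u \<in> N} = 0" by (simp add: emeasure_unif null_setsD1)
  then show ?thesis by (simp add: measure_def)
qed

text \<open>The mean of the laws of \<open>Y 0\<close>, ..., \<open>Y (N - 1)\<close>, built as the
  law of \<open>Y i u\<close> for independent uniform \<open>i\<close> and \<open>u\<close>, so that
  for \<open>N > 0\<close> it is a probability measure by construction.\<close>

definition avg_law :: "nat \<Rightarrow> (nat \<Rightarrow> real \<Rightarrow> real) \<Rightarrow> real measure" where
  "avg_law N Y = distr (measure_pmf (pmf_of_set {..<N}) \<Otimes>\<^sub>M unif) borel (\<lambda>(i, u). Y i u)"

lemma sets_avg_law [simp, measurable_cong]: "sets (avg_law N Y) = sets borel"
  by (simp add: avg_law_def)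

context
  fixes N :: nat and Y :: "nat \<Rightarrow> real \<Rightarrow> real"
  assumes N: "N > 0" and Y [measurable]: "\<And>i. Y i \<in> borel_measurable borel"
begin

lemma avg_law_measurable:
  "(\<lambda>(i, u). Y i u) \<in> borel_measurable (measure_pmf (pmf_of_set {..<N}) \<Otimes>\<^sub>M unif)"
proof -
  have "(\<lambda>(i, u). Y i u) \<in> borel_measurable (count_space UNIV \<Otimes>\<^sub>M unif)"
    by (rule measurable_pair_measure_countable1) auto
  moreover have "sets (measure_pmf (pmf_of_set {..<N}) \<Otimes>\<^sub>M unif) = sets (count_space UNIV \<Otimes>\<^sub>M unif)"
    by (intro sets_pair_measure_cong) auto
  ultimately show ?thesis using measurable_cong_sets by blast
qed

lemma avg_law_pair_prob_space: "prob_space (measure_pmf (pmf_of_set {..<N}) \<Otimes>\<^sub>M unif)"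
proof -
  interpret pair_prob_space "measure_pmf (pmf_of_set {..<N})" unif by unfold_locales
  show ?thesis by (rule P.prob_space_axioms)
qed

lemma prob_space_avg_law: "prob_space (avg_law N Y)"
  unfolding avg_law_def by (intro prob_space.prob_space_distr avg_law_pair_prob_space avg_law_measurable)

lemma measure_avg_law:
  assumes A [measurable]: "A \<in> sets borel"
  shows "measure (avg_law N Y) A = (\<Sum>i<N. measure unif {u. Y i u \<in> A}) / N"
proof -
  let ?M = "measure_pmf (pmf_of_set {..<N}) \<Otimes>\<^sub>M unif"
  let ?X = "(\<lambda>(i, u). Y i u) -` A \<inter> space ?M"
  have "emeasure (avg_law N Y) A = emeasure ?M ?X"
    unfolding avg_law_def by (rule emeasure_distr[OF avg_law_measurable A])
  also have "\<dots> = (\<integral>\<^sup>+ i. emeasure unif (Pair i -` ?X) \<partial>measure_pmf (pmf_of_set {..<N}))"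
    by (rule unif.emeasure_pair_measure_alt) (rule measurable_sets[OF avg_law_measurable A])
  also have "\<dots> = (\<integral>\<^sup>+ i. emeasure unif {u. Y i u \<in> A} \<partial>measure_pmf (pmf_of_set {..<N}))"
    by (intro nn_integral_cong arg_cong[where f = "emeasure unif"]) (auto simp: space_pair_measure)
  also have "\<dots> = (\<Sum>i<N. emeasure unif {u. Y i u \<in> A}) / N"
    using N by (subst nn_integral_pmf_of_set) auto
  also have "\<dots> = ennreal ((\<Sum>i<N. measure unif {u. Y i u \<in> A}) / N)"
    using N by (simp add: unif.emeasure_eq_measure sum_nonneg divide_ennreal ennreal_of_nat_eq_real_of_nat)
  finally show ?thesis by (simp add: measure_def sum_nonneg)
qed

lemma integral_avg_law:
  assumes g [measurable]: "g \<in> borel_measurable borel" and B: "\<And>x. \<bar>g x\<bar> \<le> B"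
  shows "(\<integral>x. g x \<partial>avg_law N Y) = (\<Sum>i<N. \<integral>u. g (Y i u) \<partial>unif) / N"
proof -
  let ?M = "measure_pmf (pmf_of_set {..<N}) \<Otimes>\<^sub>M unif"
  interpret M: prob_space ?M by (rule avg_law_pair_prob_space)
  interpret pair_sigma_finite "measure_pmf (pmf_of_set {..<N})" unif by unfold_locales
  have [measurable]: "(\<lambda>p. g (case p of (i, u) \<Rightarrow> Y i u)) \<in> borel_measurable ?M"
    by (rule measurable_compose[OF avg_law_measurable g])
  have "(\<integral>x. g x \<partial>avg_law N Y) = (\<integral>p. g (case p of (i, u) \<Rightarrow> Y i u) \<partial>?M)"
    unfolding avg_law_def by (rule integral_distr[OF avg_law_measurable g])
  also have "\<dots> = (\<integral>i. (\<integral>u. g (Y i u) \<partial>unif) \<partial>measure_pmf (pmf_of_set {..<N}))"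
    by (subst integral_fst'[symmetric]) (auto intro!: M.integrable_const_bound[of _ B] simp: B)
  also have "\<dots> = (\<Sum>i<N. \<integral>u. g (Y i u) \<partial>unif) / N"
    using N by (subst integral_pmf_of_set) auto
  finally show ?thesis .
qed

end

lemma unif_integral_bound:
  fixes h :: "real \<Rightarrow> real"
  assumes [measurable]: "h \<in> borel_measurable borel" and "\<And>u. \<bar>h u - c\<bar> \<le> e"
  shows "\<bar>(\<integral>u. h u \<partial>unif) - c\<bar> \<le> e"
proof -
  have "\<bar>h u\<bar> \<le> \<bar>c\<bar> + e" for u using assms(2)[of u] by linarith
  then have int: "integrable unif h" by (intro unif.integrable_const_bound[of _ "\<bar>c\<bar> + e"]) auto
  have "(\<integral>u. h u \<partial>unif) - c = (\<integral>u. h u - c \<partial>unif)"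
    using int unif.prob_space by (simp add: Bochner_Integration.integral_diff)
  moreover have "\<bar>\<integral>u. h u - c \<partial>unif\<bar> \<le> (\<integral>u. \<bar>h u - c\<bar> \<partial>unif)" by (rule integral_abs_bound)
  moreover have "(\<integral>u. \<bar>h u - c\<bar> \<partial>unif) \<le> (\<integral>u. e \<partial>unif)"
    using int assms(2) by (intro integral_mono) auto
  moreover have "(\<integral>u. e \<partial>unif) = e" using unif.prob_space by simp
  ultimately show ?thesis by linarith
qed

text \<open>
  For \<open>u\<close> uniform on \<open>(0, 1]\<close>, both coordinates semiconjugate the dynamics to \<open>u \<mapsto> 2 u\<close>: \<open>lin_coord\<close>
  in one step, and the cosine \<open>cheb_coord k 0\<close> after one turn around the cycle of \<open>k + 2\<close> intervals.
\<close>

definition lin_coord :: "real \<Rightarrow> real" where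
  "lin_coord u = 6 + frac u"

definition cheb_coord :: "nat \<Rightarrow> nat \<Rightarrow> real \<Rightarrow> real" where
  "cheb_coord k i u = (case i of 0 \<Rightarrow> (1/2) ^ k * cos (2 * pi * u)
    | Suc j \<Rightarrow> 4 - 2 ^ j * (drop_gap k - ((1/2) ^ k * cos (2 * pi * u))\<^sup>2))"

lemma cheb_coord_simps [simp]:
  "cheb_coord k 0 u = (1/2) ^ k * cos (2 * pi * u)"
  "cheb_coord k (Suc j) u = 4 - 2 ^ j * (drop_gap k - ((1/2) ^ k * cos (2 * pi * u))\<^sup>2)"
  by (simp_all add: cheb_coord_def)

section \<open>Semiconjugacies and location of the coordinates\<close>

lemma lin_coord_measurable [measurable]: "lin_coord \<in> borel_measurable borel"
  unfolding lin_coord_def[abs_def] frac_def by measurable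

lemma cheb_coord_measurable [measurable]: "cheb_coord k i \<in> borel_measurable borel"
  by (cases i) (simp_all add: cheb_coord_def[abs_def])

lemma branch_map_lin_coord: "branch_map k (lin_coord u) = lin_coord (2 * u)"
proof -
  have f: "0 \<le> frac u" "frac u < 1" by (simp_all add: frac_lt_1)
  have e: "frac (2 * u) = (if frac u < 1/2 then 2 * frac u else 2 * frac u - 1)"
    unfolding mult_2 frac_add[of u u] by (cases "frac u < 1/2") auto
  have "5 \<le> 6 + frac u" using f by linarith
  then show ?thesis
    unfolding lin_coord_def e by (cases "frac u < 1/2") (simp_all add: branch_map_eq(3,4))
qed

lemma lin_coord_range: "lin_coord u \<in> {6..<7}"
  by (simp add: lin_coord_def frac_lt_1)

text \<open>6 and 13/2 are the values missing from the domain; 0 is added for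
  \<open>cheb_coord\<close>, so that one finite set serves all coordinates.\<close>

lemma lin_coord_dom: "lin_coord u \<in> pm_dom 5 branch \<union> {0, 6, 13/2}"
  using lin_coord_range[of u] by (auto simp: pm_dom_branch)

text \<open>For \<open>k \<ge> 1\<close> the squared radius is at most \<open>2 / 2 ^ k\<close>,
  hence at most \<open>drop_gap k\<close>. The quadratic branches thus map the whole central
  interval to points not above 4.\<close>

lemma cheb_sq_bounds:
  assumes "k \<ge> 1"
  shows "0 \<le> drop_gap k - ((1/2) ^ k * cos x)\<^sup>2"
proof -
  have "((1/2) ^ k * cos x)\<^sup>2 = ((1/2) ^ k)\<^sup>2 * (cos x)\<^sup>2" by (simp add: power_mult_distrib)
  also have "\<dots> \<le> ((1/2) ^ k)\<^sup>2 * 1" by (intro mult_left_mono) (auto simp: abs_square_le_1)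
  also have "((1/2::real) ^ k)\<^sup>2 = (1/2) ^ k / 2 ^ k"
    by (simp add: power2_eq_square power_one_over)
  also have "(1/2) ^ k / 2 ^ k * 1 \<le> 2 / (2::real) ^ k"
    using power_le_one[of "1/2::real" k] by (simp add: divide_right_mono)
  also have "\<dots> \<le> drop_gap k" using assms by (simp add: drop_gap_def field_simps)
  finally show ?thesis by simp
qed

text \<open>The distance to 4 starts below \<open>5 / 2 ^ Suc k\<close>, up to equality, and grows
  by the factor \<open>2 ^ j\<close>. For \<open>j \<le> k\<close> it is at most 5/2, so the cycle
  stays in the third branch; it is close to 4 as long as \<open>j\<close> is well below
  \<open>k\<close>.\<close>

lemma cheb_coord_Suc_bounds:
  assumes "k \<ge> 1" "j \<le> k"
  shows "\<bar>cheb_coord k (Suc j) u - 4\<bar> \<le> 5 * 2 ^ j / 2 ^ Suc k" "cheb_coord k (Suc j) u \<in> {3/2..4}"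
proof -
  let ?s = "drop_gap k - ((1/2) ^ k * cos (2 * pi * u))\<^sup>2"
  have s: "0 \<le> ?s" using cheb_sq_bounds[OF assms(1)] .
  have "?s \<le> 5 / 2 ^ Suc k"
    using drop_gap_bounds(2)[of k] zero_le_power2[of "(1/2) ^ k * cos (2 * pi * u)"] by linarith
  then have "2 ^ j * ?s \<le> 2 ^ j * (5 / 2 ^ Suc k)" by (intro mult_left_mono) auto
  then have le: "2 ^ j * ?s \<le> 5 * 2 ^ j / 2 ^ Suc k" by (simp add: mult.commute)
  have "(2::real) ^ j \<le> 2 ^ k" using assms(2) by (intro power_increasing) auto
  then have "5 * 2 ^ j / 2 ^ Suc k \<le> (5/2 :: real)" by (simp add: field_simps)
  then have "2 ^ j * ?s \<le> 5/2" using le by linarith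
  moreover have nn: "0 \<le> 2 ^ j * ?s" using s by simp
  ultimately show "cheb_coord k (Suc j) u \<in> {3/2..4}" unfolding cheb_coord_simps by auto
  show "\<bar>cheb_coord k (Suc j) u - 4\<bar> \<le> 5 * 2 ^ j / 2 ^ Suc k"
    unfolding cheb_coord_simps using nn le by linarith
qed

lemma abs_cheb_coord_0: "k \<ge> 1 \<Longrightarrow> \<bar>cheb_coord k 0 u\<bar> \<le> 1/2"
proof -
  assume "k \<ge> 1"
  then have "(1/2::real) ^ k \<le> (1/2) ^ 1" by (intro power_decreasing) auto
  then show ?thesis
    using mult_mono[of "(1/2) ^ k" "1/2" "\<bar>cos (2 * pi * u)\<bar>" 1] by (simp add: abs_mult)
qed

lemma cheb_coord_dom:
  assumes "k \<ge> 1" "i < k + 2"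
  shows "cheb_coord k i u \<in> pm_dom 5 branch \<union> {0, 6, 13/2}" "cheb_coord k i u \<notin> {6<..<7}"
proof -
  have "cheb_coord k i u \<in> {-1/2..1/2} \<or> cheb_coord k i u \<in> {3/2..4}"
  proof (cases i)
    case 0
    then show ?thesis using abs_cheb_coord_0[OF assms(1), of u] by (auto simp del: cheb_coord_simps)
  next
    case (Suc j)
    then show ?thesis using cheb_coord_Suc_bounds(2)[of k j u] assms by auto
  qed
  then show "cheb_coord k i u \<in> pm_dom 5 branch \<union> {0, 6, 13/2}" "cheb_coord k i u \<notin> {6<..<7}"
    by (auto simp: pm_dom_branch)
qed

lemma branch_map_cheb_coord:
  assumes "k \<ge> 1" "i < k + 2"
  shows "branch_map k (cheb_coord k i u) = cheb_coord k (Suc i) u"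
proof (cases i)
  case 0
  have "cheb_coord k 0 u \<le> 1" using abs_cheb_coord_0[OF assms(1), of u] by linarith
  then show ?thesis by (simp add: 0 branch_map_eq(1))
next
  case (Suc j)
  then have "cheb_coord k i u \<in> {3/2..4}" using cheb_coord_Suc_bounds(2)[of k j u] assms by simp
  then have "branch_map k (cheb_coord k i u) = 2 * cheb_coord k i u - 4"
    by (intro branch_map_eq(2)) auto
  then show ?thesis by (simp add: Suc)
qed

text \<open>The choice of \<open>drop_gap\<close> gives
  \<open>2 ^ Suc k * drop_gap k = 4 + (1/2) ^ k\<close>, which cancels the constant 4. What remains
  is the double angle formula for the cosine, scaled by the radius.\<close>

lemma cheb_coord_return:
  assumes "k \<ge> 1"
  shows "cheb_coord k (k + 2) u = cheb_coord k 0 (2 * u)"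
proof -
  let ?e = "(1/2::real) ^ k" and ?c = "cos (2 * pi * u)"
  have g: "2 ^ Suc k * drop_gap k = 4 + ?e" using assms by (simp add: drop_gap_def)
  have e: "2 ^ k * ?e = 1" by (simp add: power_mult_distrib[symmetric])
  have "cheb_coord k (k + 2) u = 4 - 2 ^ Suc k * (drop_gap k - (?e * ?c)\<^sup>2)"
    using cheb_coord_simps(2)[of k "Suc k" u] by simp
  also have "\<dots> = 4 - 2 ^ Suc k * drop_gap k + 2 * (2 ^ k * ?e) * ?e * ?c\<^sup>2"
    by (simp add: algebra_simps power2_eq_square)
  also have "\<dots> = ?e * (2 * ?c\<^sup>2 - 1)" unfolding g e by (simp add: algebra_simps)
  also have "2 * ?c\<^sup>2 - 1 = cos (2 * (2 * pi * u))" by (rule cos_double_cos[symmetric])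
  finally show ?thesis by (simp add: mult_ac)
qed

section \<open>Absolute continuity of the coordinate laws\<close>

lemma cos_periodic_unit: "cos (2 * pi * (v + 1)) = cos (2 * pi * v)"
  by (simp add: distrib_left cos_add)

lemma unif_null_cos:
  assumes N: "N \<in> null_sets lborel" and b: "b \<noteq> 0"
  shows "measure unif {u. a + b * cos (2 * pi * u) \<in> N} = 0"
\<comment> \<open>The derivative vanishes on \<open>(0, 1]\<close> exactly at 1/2 and 1, which are
  therefore removed.\<close>
proof (rule unif_null_vimage[where S = "{0<..1} - {1/2, 1}" and f' = "\<lambda>u. - (b * (2 * pi) * sin (2 * pi * u))"])
  fix u :: real assume u: "u \<in> {0<..1} - {1/2, 1}"
  show "((\<lambda>u. a + b * cos (2 * pi * u)) has_real_derivative - (b * (2 * pi) * sin (2 * pi * u))) (at u)"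
    by (auto intro!: derivative_eq_intros)
  have "sin (2 * pi * u) \<noteq> 0"
  proof
    assume "sin (2 * pi * u) = 0"
    then obtain i :: int where "2 * pi * u = real_of_int i * pi" by (auto simp: sin_zero_iff_int2)
    then have i: "2 * u = real_of_int i" by simp
    then have "0 < real_of_int i" "real_of_int i < 2" using u by auto
    then have "i = 1" by linarith
    then show False using i u by simp
  qed
  then show "- (b * (2 * pi) * sin (2 * pi * u)) \<noteq> 0" using b by simp
next
  have "{0<..1} - ({0<..1} - {1/2, 1}) \<subseteq> {1/2, 1::real}" by auto
  then show "finite ({0<..1} - ({0<..1} - {1/2, 1::real}))" by (rule finite_subset) simp
qed (use N in auto)

lemma unif_null_cheb_coord:
  assumes N: "N \<in> null_sets lborel"
  shows "measure unif {u. cheb_coord k i u \<in> N} = 0"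
proof (cases i)
  case 0
  then show ?thesis using unif_null_cos[OF N, of "(1/2) ^ k" 0] by simp
next
  case (Suc j)
  define a where "a = 4 - 2 ^ j * drop_gap k + 2 ^ j * ((1/2) ^ k)\<^sup>2 / 2"
  define b :: real where "b = 2 ^ j * ((1/2) ^ k)\<^sup>2 / 2"
  \<comment> \<open>With the doubled angle the squared cosine is affine in a cosine, and
    \<open>unif_doubling\<close> removes the doubling, so \<open>unif_null_cos\<close> applies to
    every step of the cycle.\<close>
  have half: "(cos (2 * pi * u))\<^sup>2 = (1 + cos (2 * pi * (2 * u))) / 2" for u
    using cos_double_cos[of "2 * pi * u"] by (simp add: mult_ac)
  have "cheb_coord k i u = a + b * cos (2 * pi * (2 * u))" for u
    unfolding Suc cheb_coord_simps power_mult_distrib half a_def b_def by (simp add: field_simps)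
  then have "measure unif {u. cheb_coord k i u \<in> N} = measure unif {u. a + b * cos (2 * pi * (2 * u)) \<in> N}"
    by simp
  also have "\<dots> = measure unif {u. a + b * cos (2 * pi * u) \<in> N}"
    using N by (intro unif_doubling[of "\<lambda>v. a + b * cos (2 * pi * v)"]) (auto simp: cos_periodic_unit)
  also have "\<dots> = 0" using N by (intro unif_null_cos) (auto simp: b_def)
  finally show ?thesis .
qed

lemma frac_eq_unit: "u \<in> {0<..<1} \<Longrightarrow> frac u = u"
  by (simp add: frac_eq)

lemma unif_null_lin_coord:
  assumes N: "N \<in> null_sets lborel"
  shows "measure unif {u. lin_coord u \<in> N} = 0"
proof (rule unif_null_vimage[where S = "{0<..<1}" and f' = "\<lambda>_. 1"])
  fix u :: real assume u: "u \<in> {0<..<1}"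
  have "((\<lambda>u. 6 + u) has_real_derivative 1) (at u)" by (auto intro!: derivative_eq_intros)
  then show "(lin_coord has_real_derivative 1) (at u)"
    by (rule has_field_derivative_transform_within_open[of _ _ _ "{0<..<1}"])
       (use u in \<open>auto simp: lin_coord_def frac_eq_unit\<close>)
next
  have "{0<..1} - {0<..<1} \<subseteq> {1::real}" by auto
  then show "finite ({0<..1} - {0<..<1::real})" by (rule finite_subset) simp
qed (use N in auto)

section \<open>The invariant measures and their limit\<close>

text \<open>For \<open>k \<ge> 1\<close> the first \<open>k + 2\<close> indices run through the
  cycle. Averaging over twice as many indices, the others giving \<open>lin_coord\<close>, puts mass
  1/2 on the cycle and 1/2 on the doubling region; for \<open>k = 0\<close> only
  \<open>lin_coord\<close> occurs.\<close>

definition orbit_coord :: "nat \<Rightarrow> nat \<Rightarrow> real \<Rightarrow> real" where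
  "orbit_coord k i = (if k \<ge> 1 \<and> i < k + 2 then cheb_coord k i else lin_coord)"

definition model_acip :: "nat \<Rightarrow> real measure" where
  "model_acip k = avg_law (if k = 0 then 1 else (k + 2) + (k + 2)) (orbit_coord k)"

lemma orbit_coord_measurable [measurable]: "orbit_coord k i \<in> borel_measurable borel"
  unfolding orbit_coord_def by (cases "k \<ge> 1 \<and> i < k + 2") simp_all

lemma sum_lessThan_add:
  fixes g :: "nat \<Rightarrow> 'a::comm_monoid_add"
  shows "(\<Sum>i<m + n. g i) = (\<Sum>i<m. g i) + (\<Sum>i<n. g (m + i))"
  by (induction n) (simp_all add: add.assoc)

lemma orbit_coord_dom: "orbit_coord k i u \<in> pm_dom 5 branch \<union> {0, 6, 13/2}"
  unfolding orbit_coord_def using cheb_coord_dom(1)[of k i u] lin_coord_dom[of u] by simp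

lemma unif_null_orbit_coord:
  "N \<in> null_sets lborel \<Longrightarrow> measure unif {u. orbit_coord k i u \<in> N} = 0"
  unfolding orbit_coord_def by (simp add: unif_null_cheb_coord unif_null_lin_coord)

lemma AE_orbit_coord_dom: "AE u in unif. orbit_coord k i u \<in> pm_dom 5 branch"
proof -
  have "{0, 6, 13/2} \<in> null_sets lborel" by (intro finite_imp_null_set_lborel) simp
  from unif_null_orbit_coord[OF this] have "measure unif {u. orbit_coord k i u \<in> {0, 6, 13/2}} = 0" .
  then have "AE u in unif. u \<notin> {u. orbit_coord k i u \<in> {0, 6, 13/2}}"
    by (intro unif.prob_eq_0[THEN iffD1]) auto
  then show ?thesis
  proof eventually_elim
    case (elim u)
    then show ?case using orbit_coord_dom[of k i u] by auto
  qed
qed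

lemma prob_space_model_acip: "prob_space (model_acip k)"
  unfolding model_acip_def by (rule prob_space_avg_law) auto

lemma sets_model_acip [simp]: "sets (model_acip k) = sets borel"
  by (simp add: model_acip_def)

lemma measure_model_acip_0:
  "A \<in> sets borel \<Longrightarrow> measure (model_acip 0) A = measure unif {u. lin_coord u \<in> A}"
  unfolding model_acip_def by (subst measure_avg_law) (simp_all add: orbit_coord_def)

lemma measure_model_acip:
  assumes "A \<in> sets borel" "k \<ge> 1"
  shows "measure (model_acip k) A =
    ((\<Sum>i<k + 2. measure unif {u. cheb_coord k i u \<in> A}) / (k + 2) + measure unif {u. lin_coord u \<in> A}) / 2"
proof -
  have "measure (model_acip k) A = (\<Sum>i<(k + 2) + (k + 2). measure unif {u. orbit_coord k i u \<in> A}) / real ((k + 2) + (k + 2))"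
    unfolding model_acip_def using assms by (subst measure_avg_law) auto
  also have "(\<Sum>i<(k + 2) + (k + 2). measure unif {u. orbit_coord k i u \<in> A}) =
      (\<Sum>i<k + 2. measure unif {u. cheb_coord k i u \<in> A}) + real (k + 2) * measure unif {u. lin_coord u \<in> A}"
    unfolding sum_lessThan_add using assms(2) by (simp add: orbit_coord_def algebra_simps)
  finally show ?thesis by (simp add: field_simps)
qed

text \<open>The map moves each law of the cycle to the next, and after a full turn the law of
  \<open>cheb_coord k 0\<close> at \<open>2 * u\<close> is that at \<open>u\<close>. So the sum over
  the cycle is merely permuted; \<open>lin_coord\<close> is treated by the same doubling
  argument.\<close>

lemma measure_model_acip_shift:
  assumes [measurable]: "A \<in> sets borel"
  shows "measure (model_acip k) (branch_map k -` A) = measure (model_acip k) A"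
proof -
  have vim: "branch_map k -` A \<in> sets borel" using measurable_sets[OF branch_map_measurable assms] by simp
  have lin: "measure unif {u. lin_coord u \<in> branch_map k -` A} = measure unif {u. lin_coord u \<in> A}"
  proof -
    have "lin_coord (v + 1) = lin_coord v" for v by (simp add: lin_coord_def frac_1_eq)
    from unif_doubling[OF lin_coord_measurable this assms]
    show ?thesis by (simp add: branch_map_lin_coord)
  qed
  show ?thesis
  proof (cases "k = 0")
    case True
    then show ?thesis using lin vim by (simp add: measure_model_acip_0)
  next
    case False
    then have k: "k \<ge> 1" by simp
    let ?b = "\<lambda>i. measure unif {u. cheb_coord k i u \<in> A}"
    have "?b (k + 2) = ?b 0"
      unfolding cheb_coord_return[OF k]
      using unif_doubling[of "cheb_coord k 0" A] by (simp add: cos_periodic_unit)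
    then have "(\<Sum>i<k + 2. ?b (Suc i)) = (\<Sum>i<k + 2. ?b i)"
      using sum.lessThan_Suc_shift[of ?b "k + 2"] sum.lessThan_Suc[of ?b "k + 2"] by simp
    moreover have "(\<Sum>i<k + 2. measure unif {u. cheb_coord k i u \<in> branch_map k -` A}) = (\<Sum>i<k + 2. ?b (Suc i))"
      by (intro sum.cong refl) (simp add: branch_map_cheb_coord[OF k])
    ultimately show ?thesis
      unfolding measure_model_acip[OF vim k] measure_model_acip[OF assms k] lin by simp
  qed
qed

lemma acip_model: "acip 5 (branch_map k) branch (model_acip k)"
proof -
  interpret prob_space "model_acip k" by (rule prob_space_model_acip)
  have sp: "space (model_acip k) = UNIV" using sets_eq_imp_space_eq[OF sets_model_acip] by simp
  have one: "measure unif {u. orbit_coord k i u \<in> pm_dom 5 branch} = 1" for i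
    using AE_orbit_coord_dom[of k i] by (intro unif.prob_eq_1[THEN iffD2]) auto
  have dom: "prob (pm_dom 5 branch) = 1"
    unfolding model_acip_def by (subst measure_avg_law) (auto simp: one)
  have AE_dom: "AE x in model_acip k. x \<in> pm_dom 5 branch"
    using dom by (intro prob_eq_1[THEN iffD1]) auto
  have "prob {x \<in> pm_dom 5 branch. branch_map k x \<in> A} = prob A" if A[measurable]: "A \<in> sets borel" for A
  proof -
    have "prob {x \<in> pm_dom 5 branch. branch_map k x \<in> A} = prob (branch_map k -` A)"
    proof (rule finite_measure_eq_AE)
      show "AE x in model_acip k. (x \<in> {x \<in> pm_dom 5 branch. branch_map k x \<in> A}) = (x \<in> branch_map k -` A)"
        using AE_dom by eventually_elim simp
      show "branch_map k -` A \<in> events" using measurable_sets[OF branch_map_measurable A] by simp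
      show "{x \<in> pm_dom 5 branch. branch_map k x \<in> A} \<in> events" unfolding sets_model_acip by measurable
    qed
    then show ?thesis using measure_model_acip_shift[OF A] by simp
  qed
  moreover have "absolutely_continuous lborel (model_acip k)"
    unfolding absolutely_continuous_def
  proof
    fix N :: "real set" assume N: "N \<in> null_sets lborel"
    then have "prob N = 0"
      unfolding model_acip_def by (subst measure_avg_law) (auto simp: unif_null_orbit_coord)
    then show "N \<in> null_sets (model_acip k)"
      using N by (auto simp: null_sets_def emeasure_eq_measure)
  qed
  ultimately show ?thesis
    unfolding acip_def invariant_prob_def using dom prob_space_axioms by simp
qed

section \<open>Entropy of the invariant measures\<close>

lemma measure_unif_lin_coord: "measure unif {u. lin_coord u \<in> {6<..<7}} = 1"
proof -
  have "{6} \<in> null_sets lborel" by (intro finite_imp_null_set_lborel) simp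
  from unif_null_lin_coord[OF this] have "AE u in unif. u \<notin> {u. lin_coord u \<in> {6}}"
    by (intro unif.prob_eq_0[THEN iffD1]) auto
  then have "AE u in unif. u \<in> {u. lin_coord u \<in> {6<..<7}}"
  proof eventually_elim
    case (elim u)
    then show ?case using lin_coord_range[of u] by auto
  qed
  then show ?thesis by (intro unif.prob_eq_1[THEN iffD2]) auto
qed

lemma measure_unif_lin_coord_cball:
  assumes "r \<ge> 0"
  shows "measure unif {u. lin_coord u \<in> {6<..<7} \<inter> cball x r} \<le> 2 * r"
proof -
  have "emeasure unif {u. lin_coord u \<in> {6<..<7} \<inter> cball x r} =
      emeasure lborel ({0<..1} \<inter> {u. lin_coord u \<in> {6<..<7} \<inter> cball x r})"
    by (rule emeasure_unif) (use measurable_sets[OF lin_coord_measurable, of "{6<..<7} \<inter> cball x r"] in \<open>simp add: vimage_def\<close>)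
  also have "\<dots> \<le> emeasure lborel {x - 6 - r..x - 6 + r}"
  proof (rule emeasure_mono)
    show "{0<..1} \<inter> {u. lin_coord u \<in> {6<..<7} \<inter> cball x r} \<subseteq> {x - 6 - r..x - 6 + r}"
    proof
      fix u assume u: "u \<in> {0<..1} \<inter> {u. lin_coord u \<in> {6<..<7} \<inter> cball x r}"
      \<comment> \<open>At \<open>u = 1\<close> the fractional part is 0 and the value 6 is outside
        the open interval; elsewhere on \<open>(0, 1]\<close> the coordinate is a
        translation.\<close>
      then have "u \<noteq> 1" by (auto simp: lin_coord_def)
      then have "frac u = u" using u by (intro frac_eq_unit) auto
      then show "u \<in> {x - 6 - r..x - 6 + r}" using u by (auto simp: lin_coord_def dist_real_def abs_le_iff)
    qed
  qed simp
  also have "\<dots> = ennreal (2 * r)" using assms by simp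
  finally show ?thesis using assms by (simp add: unif.emeasure_eq_measure)
qed

text \<open>The cycle never meets \<open>(6, 7)\<close>, so there the measure has density 1 for
  \<open>k = 0\<close> and 1/2 otherwise, and \<open>ks_entropy_ge\<close> applies with mass 1 or
  1/2.\<close>

lemma model_acip_entropy:
  shows "ereal (ln 2) \<le> ks_entropy 5 (branch_map 0) branch (model_acip 0)"
    and "ereal (1/2 * ln 2) \<le> ks_entropy 5 (branch_map k) branch (model_acip k)"
proof -
  have inv: "invariant_prob 5 (branch_map k) branch (model_acip k)" for k
    using acip_model by (simp add: acip_def)
  have half: "1/2 \<le> measure (model_acip k) {6<..<7}" if "k \<ge> 1" for k
  proof -
    have "0 \<le> (\<Sum>i<k + 2. measure unif {u. cheb_coord k i u \<in> {6<..<7}}) / (k + 2)"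
      by (intro divide_nonneg_nonneg sum_nonneg) simp_all
    then show ?thesis
      unfolding measure_model_acip[OF borel_open[OF open_greaterThanLessThan] that]
        measure_unif_lin_coord by simp
  qed
  have mass0: "1 \<le> measure (model_acip 0) {6<..<7}"
    by (simp add: measure_model_acip_0 measure_unif_lin_coord del: greaterThanLessThan_iff)
  have dens: "measure (model_acip k) ({6<..<7} \<inter> cball x r) \<le> 2 * r" if r: "r \<ge> 0" for k x r
  proof (cases "k = 0")
    case True
    then show ?thesis using measure_unif_lin_coord_cball[OF r] by (simp add: measure_model_acip_0)
  next
    case False
    then have k: "k \<ge> 1" by simp
    have "{u. cheb_coord k i u \<in> {6<..<7} \<inter> cball x r} = {}" if "i < k + 2" for i
      using cheb_coord_dom(2)[OF k that] by blast
    then have "(\<Sum>i<k + 2. measure unif {u. cheb_coord k i u \<in> {6<..<7} \<inter> cball x r}) = 0"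
      by (intro sum.neutral ballI) (simp only: lessThan_iff measure_empty)
    then have "measure (model_acip k) ({6<..<7} \<inter> cball x r) =
        measure unif {u. lin_coord u \<in> {6<..<7} \<inter> cball x r} / 2"
      using k by (subst measure_model_acip) auto
    then show ?thesis
      using measure_unif_lin_coord_cball[OF r, of x]
        measure_nonneg[of unif "{u. lin_coord u \<in> {6<..<7} \<inter> cball x r}"] by linarith
  qed
  show "ereal (ln 2) \<le> ks_entropy 5 (branch_map 0) branch (model_acip 0)"
    using ks_entropy_ge[OF inv mass0 dens] by simp
  have "1/2 \<le> measure (model_acip k) {6<..<7}"
    using half[of k] mass0 by (cases "k = 0") auto
  then show "ereal (1/2 * ln 2) \<le> ks_entropy 5 (branch_map k) branch (model_acip k)"
    by (rule ks_entropy_ge[OF inv _ dens])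
qed

section \<open>The weak-star limit\<close>

definition limit_law :: "real measure" where
  "limit_law = avg_law 2 (\<lambda>i. if i = 0 then lin_coord else (\<lambda>_. 4))"

lemma lessThan_2: "{..<2} = {0, 1::nat}"
  by auto

lemma limit_law_measurable: "(if i = 0 then lin_coord else (\<lambda>_. 4)) \<in> borel_measurable borel"
  for i :: nat by (cases "i = 0") simp_all

lemma measure_limit_law:
  assumes "A \<in> sets borel"
  shows "measure limit_law A = 1/2 * measure (model_acip 0) A + (1 - 1/2) * indicator A 4"
proof -
  have "measure limit_law A = (\<Sum>i<2::nat. measure unif {u. (if i = 0 then lin_coord else (\<lambda>_. 4)) u \<in> A}) / real 2"
    unfolding limit_law_def using assms by (intro measure_avg_law limit_law_measurable) auto
  also have "\<dots> = (measure unif {u. lin_coord u \<in> A} + measure unif {u. (4::real) \<in> A}) / 2"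
    unfolding lessThan_2 by simp
  also have "measure unif {u. (4::real) \<in> A} = indicator A 4"
    using unif.prob_space by (cases "(4::real) \<in> A") simp_all
  finally show ?thesis using assms by (simp add: measure_model_acip_0)
qed

text \<open>All positions of the cycle are near 4 except index 0 and the last \<open>j0\<close>. The
  number of exceptions is bounded independently of \<open>k\<close>, while the cycle has length
  \<open>k + 2\<close>, so they disappear from the average.\<close>

lemma cheb_average_tendsto:
  fixes g :: "real \<Rightarrow> real"
  assumes g: "continuous_on UNIV g" and B: "\<And>x. \<bar>g x\<bar> \<le> B"
  shows "(\<lambda>k. (\<Sum>i<k + 2. \<integral>u. g (cheb_coord k i u) \<partial>unif) / real (k + 2)) \<longlonglongrightarrow> g 4"
proof (rule LIMSEQ_I)
  fix e :: real assume e: "e > 0"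
  have [measurable]: "g \<in> borel_measurable borel" using g by (rule borel_measurable_continuous_onI)
  have B0: "B \<ge> 0" using B[of 0] by linarith
  obtain d where d: "d > 0" "\<And>y. \<bar>y - 4\<bar> < d \<Longrightarrow> \<bar>g y - g 4\<bar> < e / 2"
    using g e unfolding continuous_on_iff dist_real_def by (metis UNIV_I half_gt_zero)
  \<comment> \<open>For \<open>j + j0 \<le> Suc k\<close> the distance bound
    \<open>5 * 2 ^ j / 2 ^ Suc k\<close> is at most \<open>5 * (1/2) ^ j0\<close>, hence smaller
    than \<open>d\<close>.\<close>
  obtain j0 where j0: "(1/2) ^ j0 < d / 5" using real_arch_pow_inv[of "d / 5" "1/2"] d by auto
  let ?c = "\<lambda>k i. \<integral>u. g (cheb_coord k i u) \<partial>unif"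
  let ?bad = "\<lambda>k. insert 0 {k + 2 - j0..<k + 2}"
  have term_le: "\<bar>?c k i - g 4\<bar> \<le> e / 2 + (if i \<in> ?bad k then 2 * B else 0)" if k: "k \<ge> 1" and i: "i < k + 2" for k i
  proof (rule unif_integral_bound)
    fix u
    show "\<bar>g (cheb_coord k i u) - g 4\<bar> \<le> e / 2 + (if i \<in> ?bad k then 2 * B else 0)"
    proof (cases "i \<in> ?bad k")
      case True
      then show ?thesis using B[of "cheb_coord k i u"] B[of 4] e by auto
    next
      case False
      then obtain j where j: "i = Suc j" using i by (cases i) auto
      then have jk: "j + j0 \<le> Suc k" "j \<le> k" using False i by auto
      have "2 ^ j / 2 ^ Suc k \<le> (2::real) ^ j / 2 ^ (j + j0)"
        using jk(1) by (intro divide_left_mono power_increasing) auto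
      also have "\<dots> = (1/2) ^ j0" by (simp add: power_add power_one_over)
      finally have "5 * 2 ^ j / 2 ^ Suc k < d" using j0 by simp
      then have "\<bar>cheb_coord k i u - 4\<bar> < d"
        using cheb_coord_Suc_bounds(1)[OF k jk(2), of u] unfolding j by linarith
      then show ?thesis unfolding if_not_P[OF False] using d(2)[of "cheb_coord k i u"] by linarith
    qed
  qed measurable
  have gen: "(\<Sum>i\<in>T. x + (if i \<in> S then y else 0)) = real (card T) * x + real (card (T \<inter> S)) * y"
    if "finite T" for T S :: "nat set" and x y :: real
    using that by (simp add: sum.distrib sum.If_cases)
  have avg: "\<bar>(\<Sum>i<k + 2. ?c k i) / real (k + 2) - g 4\<bar> \<le> e / 2 + 2 * B * (real j0 + 1) * (1 / real (k + 2))"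
    if k: "k \<ge> 1" for k
  proof -
    have "(\<Sum>i<k + 2. ?c k i) / real (k + 2) - g 4 = (\<Sum>i<k + 2. ?c k i - g 4) / real (k + 2)"
      by (simp add: sum_subtractf field_simps)
    then have "\<bar>(\<Sum>i<k + 2. ?c k i) / real (k + 2) - g 4\<bar> = \<bar>\<Sum>i<k + 2. ?c k i - g 4\<bar> / real (k + 2)"
      by simp
    also have "\<dots> \<le> (\<Sum>i<k + 2. e / 2 + (if i \<in> ?bad k then 2 * B else 0)) / real (k + 2)"
      using term_le[OF k] by (intro divide_right_mono order_trans[OF sum_abs] sum_mono) auto
    also have "\<dots> = (real (k + 2) * (e / 2) + real (card ({..<k + 2} \<inter> ?bad k)) * (2 * B)) / real (k + 2)"
      by (subst gen) simp_all
    also have "\<dots> \<le> (real (k + 2) * (e / 2) + (real j0 + 1) * (2 * B)) / real (k + 2)"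
    proof -
      have "card ({..<k + 2} \<inter> ?bad k) \<le> card (?bad k)" by (intro card_mono) auto
      also have "\<dots> \<le> Suc (card {k + 2 - j0..<k + 2})" by (simp add: card_insert_if)
      also have "\<dots> \<le> j0 + 1" by simp
      finally show ?thesis using B0 by (intro divide_right_mono add_left_mono mult_right_mono) auto
    qed
    also have "\<dots> = e / 2 + 2 * B * (real j0 + 1) * (1 / real (k + 2))"
    proof -
      have split: "(q * x + y * z) / q = x + z * y * (1 / q)" if "q \<noteq> 0" for q x y z :: real
        using that by (simp add: field_simps)
      show ?thesis by (rule split) simp
    qed
    finally show ?thesis .
  qed
  have "(\<lambda>k. 2 * B * (real j0 + 1) * (1 / real (k + 2))) \<longlonglongrightarrow> 2 * B * (real j0 + 1) * 0"
    by (intro tendsto_intros LIMSEQ_ignore_initial_segment[OF lim_1_over_n])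
  then have "\<forall>\<^sub>F k in sequentially. 2 * B * (real j0 + 1) * (1 / real (k + 2)) < e / 2"
    by (rule order_tendstoD(2)) (use e in simp)
  then have "\<forall>\<^sub>F k in sequentially. norm ((\<Sum>i<k + 2. ?c k i) / real (k + 2) - g 4) < e"
    using eventually_ge_at_top[of 1]
  proof eventually_elim
    case (elim k)
    then show ?case using avg[of k] by simp
  qed
  then show "\<exists>no. \<forall>k\<ge>no. norm ((\<Sum>i<k + 2. ?c k i) / real (k + 2) - g 4) < e"
    by (simp add: eventually_sequentially)
qed

lemma model_acip_weak_star: "weak_star_conv model_acip limit_law"
  unfolding weak_star_conv_def
proof (intro allI impI)
  fix g :: "real \<Rightarrow> real" assume "continuous_on UNIV g \<and> bounded (range g)"
  then have g: "continuous_on UNIV g" and "bounded (range g)" by auto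
  then obtain B where B: "\<And>x. \<bar>g x\<bar> \<le> B" by (auto simp: bounded_iff)
  have gm [measurable]: "g \<in> borel_measurable borel" using g by (rule borel_measurable_continuous_onI)
  have lim: "(\<integral>x. g x \<partial>limit_law) = (g 4 + (\<integral>u. g (lin_coord u) \<partial>unif)) / 2"
  proof -
    have "(\<integral>x. g x \<partial>limit_law) = (\<Sum>i<2::nat. \<integral>u. g ((if i = 0 then lin_coord else (\<lambda>_. 4)) u) \<partial>unif) / real 2"
      unfolding limit_law_def by (intro integral_avg_law[where B = B] limit_law_measurable gm B) simp
    also have "\<dots> = ((\<integral>u. g (lin_coord u) \<partial>unif) + (\<integral>u. g 4 \<partial>unif)) / 2"
      unfolding lessThan_2 by simp
    also have "(\<integral>u. g 4 \<partial>unif) = g 4" using unif.prob_space by simp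
    finally show ?thesis by simp
  qed
  have int: "(\<integral>x. g x \<partial>model_acip k) =
      ((\<Sum>i<k + 2. \<integral>u. g (cheb_coord k i u) \<partial>unif) / real (k + 2) + (\<integral>u. g (lin_coord u) \<partial>unif)) / 2"
    if k: "k \<ge> 1" for k
  proof -
    have "(\<integral>x. g x \<partial>model_acip k) = (\<Sum>i<(k + 2) + (k + 2). \<integral>u. g (orbit_coord k i u) \<partial>unif) / real ((k + 2) + (k + 2))"
      unfolding model_acip_def using k by (subst integral_avg_law[OF _ _ gm B]) auto
    also have "(\<Sum>i<(k + 2) + (k + 2). \<integral>u. g (orbit_coord k i u) \<partial>unif) =
        (\<Sum>i<k + 2. \<integral>u. g (cheb_coord k i u) \<partial>unif) + real (k + 2) * (\<integral>u. g (lin_coord u) \<partial>unif)"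
      unfolding sum_lessThan_add using k by (simp add: orbit_coord_def algebra_simps)
    finally show ?thesis by (simp add: field_simps)
  qed
  have "(\<lambda>k. ((\<Sum>i<k + 2. \<integral>u. g (cheb_coord k i u) \<partial>unif) / real (k + 2) + (\<integral>u. g (lin_coord u) \<partial>unif)) / 2)
      \<longlonglongrightarrow> (g 4 + (\<integral>u. g (lin_coord u) \<partial>unif)) / 2"
    by (intro tendsto_intros cheb_average_tendsto[OF g B]) auto
  then show "(\<lambda>k. \<integral>x. g x \<partial>model_acip k) \<longlonglongrightarrow> (\<integral>x. g x \<partial>limit_law)"
    unfolding lim
  proof (rule Lim_transform_eventually)
    show "\<forall>\<^sub>F k in sequentially. ((\<Sum>i<k + 2. \<integral>u. g (cheb_coord k i u) \<partial>unif) / real (k + 2) +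
        (\<integral>u. g (lin_coord u) \<partial>unif)) / 2 = (\<integral>x. g x \<partial>model_acip k)"
      using eventually_ge_at_top[of 1] by eventually_elim (simp only: int)
  qed
qed

lemma repelling_fixed_point_4: "repelling_fixed_point 5 (branch_map 0) branch 4"
proof -
  have "4 \<in> pm_dom 5 branch" by (simp add: pm_dom_branch)
  from has_field_derivative_at_within[OF branch_map_has_derivative[OF this]]
  have "(branch_map 0 has_real_derivative 2) (at 4 within branch 2)" by (simp add: branch_slope_def)
  then show ?thesis
    unfolding repelling_fixed_point_def
    by (intro exI[of _ 2]) (auto simp: branch_map_eq(2) intro!: exI[of _ "2::real"])
qed

theorem mainTheorem15:
  shows "\<exists>(a::real) b (d::nat) (F :: nat \<Rightarrow> real \<Rightarrow> real) (J :: nat \<Rightarrow> nat \<Rightarrow> real set)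
            (h :: nat \<Rightarrow> real \<Rightarrow> real) (g :: nat \<Rightarrow> real \<Rightarrow> real) (\<mu> :: nat \<Rightarrow> real measure).
     a < b \<and> d \<ge> 1 \<and>
     NSD_family {a..b} d F J \<and>
     pm_conv_via {a..b} d F J h g \<and>
     decreasing_crit_rels d F J g \<and>
     (\<forall>k. acip d (F k) (J k) (\<mu> k)) \<and>
     (\<exists>\<delta>>0. \<forall>k. ereal \<delta> \<le> ks_entropy d (F k) (J k) (\<mu> k)) \<and>
     equilibrium_state d (F 0) (J 0) (\<mu> 0) \<and>
     (\<exists>t p \<nu>. 0 < t \<and> t < 1 \<and> repelling_fixed_point d (F 0) (J 0) p \<and>
        prob_space \<nu> \<and> sets \<nu> = sets borel \<and>
        (\<forall>A\<in>sets borel. measure \<nu> A = t * measure (\<mu> 0) A + (1 - t) * indicator A p) \<and>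
        weak_star_conv \<mu> \<nu>)"
proof (rule exI[of _ "-2"], rule exI[of _ 7], rule exI[of _ 5], rule exI[of _ branch_map],
    rule exI[of _ "\<lambda>_. branch"], rule exI[of _ "\<lambda>_. id"], rule exI[of _ "\<lambda>_. id"],
    rule exI[of _ model_acip], intro conjI)
  show "\<exists>\<delta>>0. \<forall>k. ereal \<delta> \<le> ks_entropy 5 (branch_map k) branch (model_acip k)"
    using model_acip_entropy(2) by (intro exI[of _ "1/2 * ln 2"]) simp
  show "equilibrium_state 5 (branch_map 0) branch (model_acip 0)"
    using acip_model model_acip_entropy(1) by (intro equilibrium_stateI) (auto simp: acip_def)
  have prob: "prob_space limit_law"
    unfolding limit_law_def by (intro prob_space_avg_law limit_law_measurable) simp
  have sets: "sets limit_law = sets borel" by (simp add: limit_law_def)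
  show "\<exists>t p \<nu>. 0 < t \<and> t < 1 \<and> repelling_fixed_point 5 (branch_map 0) branch p \<and>
      prob_space \<nu> \<and> sets \<nu> = sets borel \<and>
      (\<forall>A\<in>sets borel. measure \<nu> A = t * measure (model_acip 0) A + (1 - t) * indicator A p) \<and>
      weak_star_conv model_acip \<nu>"
    \<comment> \<open>Weight 1/2 is the mass that each \<open>model_acip k\<close> with
      \<open>k \<ge> 1\<close> gives to the doubling region, and 4 is the fixed point near which the
      cycle spends most of its steps for large \<open>k\<close>.\<close>
    by (rule exI[of _ "1/2"], rule exI[of _ 4], rule exI[of _ limit_law])
       (use prob sets measure_limit_law repelling_fixed_point_4 model_acip_weak_star in simp)
qed (use NSD_family_branch pm_conv_via_branch decreasing_crit_rels_branch acip_model in simp_all)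

end
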